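(* If $T\ne K_2$ is a tree with $\ell\ge 2$ leaves and if $\mathcal{F}$ is a family of graphs such that $\mathrm{ex}(n,T,\mathcal{F})=O(n^\ell)$, then either $\mathrm{ex}(n,T,\mathcal{F})=\Theta(n^k)$ for some integer $k$ or $\mathrm{ex}(n,T,\mathcal{F})=0$ for all sufficiently large $n$.
   Context: Graphs are finite and simple. A leaf of a tree is a vertex of degree $1$. A graph is $\mathcal{F}$-free, for a family of graphs $\mathcal{F}$, if it contains no (not necessarily induced) subgraph isomorphic to a member of $\mathcal{F}$. $\mathrm{ex}(n,T,\mathcal{F})$ is the maximum number of copies of $T$ (subgraphs isomorphic to $T$) that an $n$-vertex $\mathcal{F}$-free graph can have, with the convention that it is $0$ if there is no $\mathcal{F}$-free graph on $n$ vertices. Asymptotics are as $n\to\infty$, with $T$ and $\mathcal{F}$ fixed. *)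

theory Defs
  imports Complex_Main "HOL-Library.Landau_Symbols"
begin

text \<open>
  Undirected graphs are pairs of a vertex set and a set of edges, the edges being two-element
  vertex sets. (The symmetric digraphs of the AFP entry Graph_Theory are not used: there
  \<open>a, b, a\<close> counts as a cycle, so its notion of tree does not apply to undirected graphs.)
\<close>

type_synonym 'a ugraph = "'a set \<times> 'a set set"

abbreviation verts :: "'a ugraph \<Rightarrow> 'a set" where
  "verts G \<equiv> fst G"

abbreviation edges :: "'a ugraph \<Rightarrow> 'a set set" where
  "edges G \<equiv> snd G"

definition fin_simple_graph :: "'a ugraph \<Rightarrow> bool" where
  "fin_simple_graph G \<longleftrightarrow>
     finite (verts G) \<and> (\<forall>e\<in>edges G. e \<subseteq> verts G \<and> card e = 2)"

definition complete_graph :: "nat \<Rightarrow> nat ugraph" where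
  "complete_graph n = ({..<n}, {e. e \<subseteq> {..<n} \<and> card e = 2})"

definition isomorphic :: "'a ugraph \<Rightarrow> 'b ugraph \<Rightarrow> bool" where
  "isomorphic G H \<longleftrightarrow>
     (\<exists>f. bij_betw f (verts G) (verts H) \<and> (\<lambda>e. f ` e) ` edges G = edges H)"

definition subgraph :: "'a ugraph \<Rightarrow> 'a ugraph \<Rightarrow> bool" where
  "subgraph H G \<longleftrightarrow>
     fin_simple_graph H \<and> verts H \<subseteq> verts G \<and> edges H \<subseteq> edges G"

definition connected_graph :: "'a ugraph \<Rightarrow> bool" where
  "connected_graph G \<longleftrightarrow>
     verts G \<noteq> {} \<and>
     (\<forall>u\<in>verts G. \<forall>v\<in>verts G. (u, v) \<in> {(x, y). {x, y} \<in> edges G}\<^sup>*)"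

text \<open>A cycle is given by the list of its vertices, the first vertex not being repeated at the end.\<close>

definition is_cycle :: "'a ugraph \<Rightarrow> 'a list \<Rightarrow> bool" where
  "is_cycle G p \<longleftrightarrow>
     3 \<le> length p \<and> distinct p \<and>
     (\<forall>i<length p. {p ! i, p ! (Suc i mod length p)} \<in> edges G)"

definition is_tree :: "'a ugraph \<Rightarrow> bool" where
  "is_tree T \<longleftrightarrow> fin_simple_graph T \<and> connected_graph T \<and> (\<nexists>p. is_cycle T p)"

definition degree :: "'a ugraph \<Rightarrow> 'a \<Rightarrow> nat" where
  "degree G v = card {e \<in> edges G. v \<in> e}"

definition leaves :: "'a ugraph \<Rightarrow> 'a set" where
  "leaves T = {v \<in> verts T. degree T v = 1}"

definition copies :: "'a ugraph \<Rightarrow> 'b ugraph \<Rightarrow> 'b ugraph set" where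
  "copies T G = {H. subgraph H G \<and> isomorphic T H}"

definition family_free :: "'a ugraph set \<Rightarrow> 'b ugraph \<Rightarrow> bool" where
  "family_free \<F> G \<longleftrightarrow> (\<forall>F\<in>\<F>. copies F G = {})"

text \<open>
  Every finite graph is isomorphic to one whose vertices are natural numbers, so the host graphs
  range over graphs on \<open>n\<close> naturals.
\<close>

definition copy_counts :: "nat \<Rightarrow> 'a ugraph \<Rightarrow> 'b ugraph set \<Rightarrow> nat set" where
  "copy_counts n T \<F> =
     {card (copies T G) | G :: nat ugraph.
        fin_simple_graph G \<and> card (verts G) = n \<and> family_free \<F> G}"

definition gen_turan :: "nat \<Rightarrow> 'a ugraph \<Rightarrow> 'b ugraph set \<Rightarrow> nat" where
  "gen_turan n T \<F> =
     (if copy_counts n T \<F> = {} then 0 else Max (copy_counts n T \<F>))"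

text \<open>The following two facts ensure that \<open>card\<close> and \<open>Max\<close> above have their intended meaning.\<close>

lemma copies_subset: "copies T G \<subseteq> Pow (verts G) \<times> Pow (Pow (verts G))"
  unfolding copies_def subgraph_def fin_simple_graph_def by fastforce

lemma finite_copies: "fin_simple_graph G \<Longrightarrow> finite (copies T G)"
  by (rule finite_subset[OF copies_subset]) (simp add: fin_simple_graph_def)

lemma finite_copy_counts: "finite (copy_counts n T \<F>)"
proof (rule finite_subset)
  show "copy_counts n T \<F> \<subseteq> {..2 ^ n * 2 ^ (2 ^ n)}"
  proof
    fix c assume "c \<in> copy_counts n T \<F>"
    then obtain G :: "nat ugraph" where
      G: "fin_simple_graph G" "card (verts G) = n" and c: "c = card (copies T G)"
      by (auto simp: copy_counts_def)
    have fin: "finite (verts G)" using G by (simp add: fin_simple_graph_def)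
    have "c \<le> card (Pow (verts G) \<times> Pow (Pow (verts G)))"
      unfolding c by (rule card_mono[OF _ copies_subset]) (simp add: fin)
    also have "\<dots> = 2 ^ n * 2 ^ (2 ^ n)"
      using G fin by (simp add: card_cartesian_product card_Pow)
    finally show "c \<in> {..2 ^ n * 2 ^ (2 ^ n)}" by simp
  qed
qed simp

end

theory Submission
  imports Defs "HOL-Library.FuncSet" "HOL-Library.Transitive_Closure_Table"
begin

text \<open>
  Take the largest \<open>m\<close> for which \<open>\<F>\<close>-free graphs contain arbitrarily large blow-ups of \<open>T\<close> with \<open>m\<close>
  independently replicated parts. Choosing one of \<open>p\<close> replicas for each part gives \<open>p ^ m\<close> copies
  of \<open>T\<close>, hence the lower bound \<open>\<Omega>(n ^ m)\<close>.

  If the number of edges of \<open>\<F>\<close>-free graphs is not \<open>O(n)\<close>, such graphs have subgraphs of arbitrarily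
  large minimum degree, into which \<open>T\<close> embeds with all leaves replicated; so \<open>m \<ge> l\<close>, and the
  assumed bound \<open>O(n ^ l)\<close> is sharp.

  Otherwise, for an embedding \<open>\<phi>\<close> consider the subtrees of \<open>T\<close> that can be moved to many disjoint
  places while \<open>\<phi>\<close> stays fixed on their boundary. At most \<open>m\<close> of these are pairwise disjoint and
  non-adjacent, so by a Helly-type argument some \<open>m\<close> edges of \<open>T\<close> meet all of them. As the host has
  \<open>O(n)\<close> edges, these \<open>m\<close> edges have \<open>O(n ^ m)\<close> images, and their image determines \<open>\<phi>\<close> up to
  boundedly many choices: a large sunflower of embeddings agreeing on the \<open>m\<close> edges would make a
  component of its petals a movable subtree that avoids them.
\<close>

section \<open>Trees grown by attaching pendant vertices\<close>

text \<open>An induction principle for trees: the parent function and the greedy embedding are both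
  obtained by following this growth.\<close>

inductive tree_build :: "'a set \<Rightarrow> 'a set set \<Rightarrow> bool" where
  base: "tree_build {r} {}"
| step: "tree_build X E \<Longrightarrow> x \<in> X \<Longrightarrow> y \<notin> X \<Longrightarrow> tree_build (insert y X) (insert {x, y} E)"

lemma tree_build_edges_subset: "tree_build X E \<Longrightarrow> e \<in> E \<Longrightarrow> e \<subseteq> X"
  by (induction rule: tree_build.induct) auto

text \<open>The relation keeps the whole walk inside \<open>X\<close>, so that it can later be
  closed to a cycle through a vertex outside \<open>X\<close>.\<close>

lemma tree_build_connected:
  assumes "tree_build X E" "u \<in> X" "v \<in> X"
  shows "(\<lambda>a b. a \<in> X \<and> b \<in> X \<and> {a, b} \<in> E)\<^sup>*\<^sup>* u v"
  using assms
proof (induction arbitrary: u v rule: tree_build.induct)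
  case (base r)
  then show ?case by simp
next
  case (step X E x y)
  let ?R = "\<lambda>a b. a \<in> X \<and> b \<in> X \<and> {a, b} \<in> E"
  let ?R' = "\<lambda>a b. a \<in> insert y X \<and> b \<in> insert y X \<and> {a, b} \<in> insert {x, y} E"
  have mono: "?R'\<^sup>*\<^sup>* a b" if "?R\<^sup>*\<^sup>* a b" for a b
    using that by (rule rtranclp_mono[THEN predicate2D, rotated]) auto
  have xy: "?R'\<^sup>*\<^sup>* x y" and yx: "?R'\<^sup>*\<^sup>* y x"
    using step.hyps by (auto intro!: r_into_rtranclp simp: insert_commute)
  have to_x: "?R'\<^sup>*\<^sup>* a x" and from_x: "?R'\<^sup>*\<^sup>* x a" if "a \<in> insert y X" for a
    using that xy yx step.IH[of a x] step.IH[of x a] step.hyps mono by auto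
  show ?case
    using to_x[OF step.prems(1)] from_x[OF step.prems(2)] by (rule rtranclp_trans)
qed

text \<open>Two different neighbours of \<open>y\<close> in \<open>X\<close> would be joined by a
  path inside \<open>X\<close>, and \<open>y\<close> would close this path to a cycle.\<close>

lemma tree_two_neighbours_eq:
  assumes T: "\<nexists>p. is_cycle T p"
    and X: "tree_build X {e \<in> edges T. e \<subseteq> X}"
    and x: "x \<in> X" "x' \<in> X" and y: "y \<notin> X"
    and e: "{x, y} \<in> edges T" "{x', y} \<in> edges T"
  shows "x = x'"
proof (rule ccontr)
  assume ne: "x \<noteq> x'"
  let ?R = "\<lambda>a b. a \<in> X \<and> b \<in> X \<and> {a, b} \<in> {e \<in> edges T. e \<subseteq> X}"
  have "?R\<^sup>*\<^sup>* x x'" using tree_build_connected[OF X x] .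
  then obtain ys where "rtrancl_path ?R x ys x'" by (auto simp: rtranclp_eq_rtrancl_path)
  then obtain xs where xs: "rtrancl_path ?R x xs x'" "distinct (x # xs)"
    by (rule rtrancl_path_distinct)
  have step: "?R ((x # xs) ! i) (xs ! i)" if "i < length xs" for i
    using rtrancl_path_nth[OF xs(1) that] .
  have "xs \<noteq> []" using xs(1) ne by (auto elim: rtrancl_path.cases)
  then have last: "last xs = x'" using rtrancl_path_last[OF xs(1)] by simp
  have inX: "set xs \<subseteq> X" using step by (auto simp: in_set_conv_nth)
  have "is_cycle T (y # x # xs)"
    unfolding is_cycle_def
  proof (intro conjI allI impI)
    show "3 \<le> length (y # x # xs)" using \<open>xs \<noteq> []\<close> by (cases xs) auto
    show "distinct (y # x # xs)" using xs(2) inX x y by auto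
    fix i assume i: "i < length (y # x # xs)"
    \<comment> \<open>The edge from \<open>y\<close> to \<open>x\<close>, an edge of the path, and
      the closing edge from \<open>x'\<close> back to \<open>y\<close>.\<close>
    consider "i = 0" | j where "i = Suc j" "j < length xs" | "i = Suc (length xs)"
      using i by (cases i) (auto simp: less_Suc_eq)
    then show "{(y # x # xs) ! i, (y # x # xs) ! (Suc i mod length (y # x # xs))} \<in> edges T"
    proof cases
      case 1
      then show ?thesis using e \<open>xs \<noteq> []\<close> by (simp add: insert_commute)
    next
      case 2
      then show ?thesis using step[of j] by simp
    next
      case 3
      then show ?thesis using e last \<open>xs \<noteq> []\<close> by (simp add: last_conv_nth nth_Cons')
    qed
  qed
  then show False using T by blast
qed

text \<open>Induction on the number of vertices outside \<open>X\<close>, with the induced edge set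
  as invariant. Connectedness supplies an edge leaving \<open>X\<close>; acyclicity makes it the
  only edge from its outer end to \<open>X\<close>, so the induced edge set grows by exactly this
  edge.\<close>

lemma tree_build_extend:
  assumes T: "is_tree T" and X: "tree_build X {e \<in> edges T. e \<subseteq> X}" "X \<subseteq> verts T"
  shows "tree_build (verts T) (edges T)"
  using X
proof (induction "card (verts T - X)" arbitrary: X rule: less_induct)
  case less
  have fin: "finite (verts T)" and es: "\<And>e. e \<in> edges T \<Longrightarrow> e \<subseteq> verts T \<and> card e = 2"
    using T by (auto simp: is_tree_def fin_simple_graph_def)
  show ?case
  proof (cases "X = verts T")
    case True
    then have "{e \<in> edges T. e \<subseteq> X} = edges T" using es by auto
    then show ?thesis using less.prems(1) True by simp
  next
    case False
    obtain r where r: "r \<in> X" using less.prems(1) by (cases rule: tree_build.cases) auto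
    obtain z where z: "z \<in> verts T" "z \<notin> X" using False less.prems by auto
    have "(r, z) \<in> {(x, y). {x, y} \<in> edges T}\<^sup>*"
      using T r z less.prems by (auto simp: is_tree_def connected_graph_def)
    \<comment> \<open>A walk from \<open>r\<close> in \<open>X\<close> to a vertex outside
      \<open>X\<close> crosses an edge that leaves \<open>X\<close>.\<close>
    then have "z \<notin> X \<longrightarrow> (\<exists>x\<in>X. \<exists>y. y \<notin> X \<and> {x, y} \<in> edges T)"
    proof (induction rule: rtrancl_induct)
      case base
      then show ?case using r by simp
    next
      case (step y z)
      then show ?case by (cases "y \<in> X") auto
    qed
    then obtain x y where xy: "x \<in> X" "y \<notin> X" "{x, y} \<in> edges T" using z by auto
    have "y \<in> verts T" using xy es by auto
    have eq: "{e \<in> edges T. e \<subseteq> insert y X} = insert {x, y} {e \<in> edges T. e \<subseteq> X}" (is "?L = ?R")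
    proof
      show "?R \<subseteq> ?L" using xy by auto
      show "?L \<subseteq> ?R"
      proof
        fix e assume e: "e \<in> ?L"
        show "e \<in> ?R"
        proof (cases "y \<in> e")
          case False
          then show ?thesis using e by auto
        next
          case True
          have "card e = 2" using e es by auto
          then obtain a b where "e = {a, b}" "a \<noteq> b" by (auto simp: card_2_iff)
          then obtain x' where x': "e = {x', y}" "x' \<noteq> y" using True by (cases "a = y") auto
          then have "x' \<in> X" using e by auto
          then have "x = x'"
            using tree_two_neighbours_eq[OF _ less.prems(1) xy(1) _ xy(2,3)] x' e T
            by (auto simp: is_tree_def)
          then show ?thesis using x' by simp
        qed
      qed
    qed
    have "tree_build (insert y X) {e \<in> edges T. e \<subseteq> insert y X}"
      unfolding eq by (rule tree_build.step[OF less.prems(1) xy(1,2)])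
    moreover have "card (verts T - insert y X) < card (verts T - X)"
      using \<open>y \<in> verts T\<close> xy fin by (intro psubset_card_mono) auto
    ultimately show ?thesis using less.hyps less.prems(2) \<open>y \<in> verts T\<close> by simp
  qed
qed

lemma tree_build_of_tree:
  assumes "is_tree T"
  shows "tree_build (verts T) (edges T)"
proof -
  obtain r where r: "r \<in> verts T" using assms by (auto simp: is_tree_def connected_graph_def)
  have none: "{e \<in> edges T. e \<subseteq> {r}} = {}"
  proof -
    have False if e: "e \<in> edges T" "e \<subseteq> {r}" for e
    proof -
      have "card e = 2" using assms e(1) by (simp add: is_tree_def fin_simple_graph_def)
      then show False using card_mono[OF _ e(2)] by simp
    qed
    then show ?thesis by blast
  qed
  have "tree_build {r} {e \<in> edges T. e \<subseteq> {r}}" unfolding none by (rule tree_build.base)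
  then show ?thesis using tree_build_extend[OF assms] r by simp
qed

section \<open>Rooted trees and their subtrees\<close>

text \<open>Edges are indexed by their lower ends, the non-root vertices. The labels
  \<open>idx\<close> decrease towards the root and serve as induction measure and as depth for
  greedy choices. \<open>par r\<close> is unconstrained.\<close>

locale rooted_tree =
  fixes T :: "'a ugraph" and r :: 'a and par :: "'a \<Rightarrow> 'a" and idx :: "'a \<Rightarrow> nat"
  assumes fin: "finite (verts T)"
    and root: "r \<in> verts T"
    and par_in: "v \<in> verts T \<Longrightarrow> v \<noteq> r \<Longrightarrow> par v \<in> verts T"
    and idx_par: "v \<in> verts T \<Longrightarrow> v \<noteq> r \<Longrightarrow> idx (par v) < idx v"
    and edges_eq: "edges T = (\<lambda>v. {v, par v}) ` (verts T - {r})"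

lemma rooted_tree_of_build:
  assumes "tree_build X E"
  shows "\<exists>r par idx. rooted_tree (X, E) r par idx"
  using assms
proof (induction rule: tree_build.induct)
  case (base r)
  show ?case by (rule exI[of _ r]) (simp add: rooted_tree_def)
next
  case (step X E x y)
  then obtain r par idx where "rooted_tree (X, E) r par idx" by blast
  then interpret R: rooted_tree "(X, E)" r par idx .
  let ?par = "par(y := x)" and ?idx = "idx(y := Suc (idx x))"
  have "rooted_tree (insert y X, insert {x, y} E) r ?par ?idx"
  proof
    show "finite (verts (insert y X, insert {x, y} E))" using R.fin by simp
    show "r \<in> verts (insert y X, insert {x, y} E)" using R.root by simp
    fix v assume "v \<in> verts (insert y X, insert {x, y} E)" "v \<noteq> r"
    then show "?par v \<in> verts (insert y X, insert {x, y} E)" "?idx (?par v) < ?idx v"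
      using step.hyps R.par_in[of v] R.idx_par[of v] by auto
  next
    have "insert y X - {r} = insert y (X - {r})" using step.hyps R.root by auto
    moreover have "(\<lambda>v. {v, ?par v}) ` (X - {r}) = (\<lambda>v. {v, par v}) ` (X - {r})"
      using step.hyps by (intro image_cong) auto
    ultimately show "edges (insert y X, insert {x, y} E) =
      (\<lambda>v. {v, ?par v}) ` (verts (insert y X, insert {x, y} E) - {r})"
      using R.edges_eq by (simp add: insert_commute)
  qed
  then show ?case by blast
qed

definition separated :: "'a ugraph \<Rightarrow> 'a set \<Rightarrow> 'a set \<Rightarrow> bool" where
  "separated T W W' \<longleftrightarrow> W \<inter> W' = {} \<and> (\<forall>x\<in>W. \<forall>y\<in>W'. {x, y} \<notin> edges T)"

lemma separated_sym: "separated T W W' \<Longrightarrow> separated T W' W"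
  unfolding separated_def by (metis inf_commute insert_commute)

definition boundary :: "'a ugraph \<Rightarrow> 'a set \<Rightarrow> 'a set" where
  "boundary T W = {y \<in> verts T - W. \<exists>x\<in>W. {x, y} \<in> edges T}"

context rooted_tree
begin

text \<open>A connected vertex set of the tree, described by its vertex \<open>s\<close> nearest the
  root: climbing to the parent leaves \<open>W\<close> at most from \<open>s\<close>. The condition
  \<open>w \<noteq> r\<close> is there because \<open>par r\<close> has no meaning.\<close>

definition subtree_top :: "'a set \<Rightarrow> 'a \<Rightarrow> bool" where
  "subtree_top W s \<longleftrightarrow> W \<subseteq> verts T \<and> s \<in> W \<and> (\<forall>w\<in>W - {s}. w \<noteq> r \<and> par w \<in> W)"

text \<open>Climbing from \<open>w\<close> stays inside \<open>W\<close> and lowers the index until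
  it reaches \<open>s\<close>.\<close>

lemma subtree_top_idx:
  assumes "subtree_top W s" "w \<in> W"
  shows "w = s \<or> idx s < idx w"
  using assms(2)
proof (induction "idx w" arbitrary: w rule: less_induct)
  case less
  show ?case
  proof (cases "w = s")
    case False
    then have "w \<in> verts T" "w \<noteq> r" "par w \<in> W"
      using assms(1) less.prems by (auto simp: subtree_top_def)
    then show ?thesis using less.hyps[of "par w"] idx_par[of w] by auto
  qed simp
qed

lemma edge_cases:
  assumes "{x, y} \<in> edges T"
  shows "(x \<noteq> r \<and> y = par x \<and> x \<in> verts T) \<or> (y \<noteq> r \<and> x = par y \<and> y \<in> verts T)"
  using assms unfolding edges_eq by (auto simp: doubleton_eq_iff)

text \<open>As the top of \<open>W\<close> has at least the index of the top of \<open>W'\<close>,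
  the two subtrees can only meet at \<open>s\<close> or be joined by the edge above
  \<open>s\<close>, and both are excluded.\<close>

lemma separated_subtrees:
  assumes W: "subtree_top W s" and W': "subtree_top W' s'"
    and le: "idx s' \<le> idx s" and s: "s \<notin> W'" and ps: "s \<noteq> r \<Longrightarrow> par s \<notin> W'"
  shows "separated T W W'"
proof -
  have "s' \<noteq> s" using s W' by (auto simp: subtree_top_def)
  then have s'W: "s' \<notin> W" using subtree_top_idx[OF W, of s'] le by auto
  \<comment> \<open>A common vertex is neither of the two tops, so its parent is common too and has
    smaller index.\<close>
  have disj: "x \<in> W \<Longrightarrow> x \<notin> W'" for x
  proof (induction "idx x" arbitrary: x rule: less_induct)
    case less
    show ?case
    proof
      assume xW': "x \<in> W'"
      have "x \<noteq> s" "x \<noteq> s'" using xW' s less.prems s'W by auto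
      then have "par x \<in> W" "par x \<in> W'" "x \<noteq> r" "x \<in> verts T"
        using W W' xW' less.prems by (auto simp: subtree_top_def)
      then show False using less.hyps idx_par by blast
    qed
  qed
  have "{x, y} \<notin> edges T" if x: "x \<in> W" and y: "y \<in> W'" for x y
  proof
    assume "{x, y} \<in> edges T"
    then consider "x \<noteq> r" "y = par x" "x \<in> verts T" | "y \<noteq> r" "x = par y" "y \<in> verts T"
      using edge_cases by blast
    then show False
    proof cases
      case 1
      then show False using W x y disj ps by (cases "x = s") (auto simp: subtree_top_def)
    next
      case 2
      show False
      proof (cases "y = s'")
        case True
        then show False using 2 idx_par[of y] subtree_top_idx[OF W x] le by auto
      next
        case False
        then have "par y \<in> W'" using W' y by (auto simp: subtree_top_def)
        then show False using 2 x disj by auto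
      qed
    qed
  qed
  then show ?thesis using disj by (auto simp: separated_def)
qed

text \<open>A vertex \<open>v \<in> S\<close> stands for the edge joining \<open>v\<close> to its parent.\<close>

lemma subtree_hitting:
  assumes "finite \<G>" and "\<And>W. W \<in> \<G> \<Longrightarrow> \<exists>s. subtree_top W s"
    and r': "verts T \<noteq> {r}"
  shows "\<exists>\<W> S. \<W> \<subseteq> \<G> \<and> pairwise (separated T) \<W> \<and> S \<subseteq> verts T - {r} \<and> card S \<le> card \<W> \<and>
    (\<forall>W\<in>\<G>. \<exists>v\<in>S. v \<in> W \<or> par v \<in> W)"
  using assms(1,2)
proof (induction "card \<G>" arbitrary: \<G> rule: less_induct)
  case less
  show ?case
  proof (cases "\<G> = {}")
    case True
    then show ?thesis by (intro exI[of _ "{}"]) auto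
  next
    case False
    define top where "top W = (SOME s. subtree_top W s)" for W
    have top: "subtree_top W (top W)" if "W \<in> \<G>" for W
      unfolding top_def using less.prems(2)[OF that] by (rule someI_ex)
    \<comment> \<open>Greedy: a deepest top. Whatever avoids the edge above it is separated from \<open>W\<close>.\<close>
    obtain W where W: "W \<in> \<G>" "\<And>W'. W' \<in> \<G> \<Longrightarrow> idx (top W') \<le> idx (top W)"
    proof -
      have "Max ((\<lambda>W. idx (top W)) ` \<G>) \<in> (\<lambda>W. idx (top W)) ` \<G>"
        using False less.prems(1) by (intro Max_in) auto
      then obtain W where "W \<in> \<G>" "idx (top W) = Max ((\<lambda>W. idx (top W)) ` \<G>)" by auto
      then show thesis using that[of W] less.prems(1) by simp
    qed
    obtain c where c: "c \<in> verts T - {r}" and sc: "top W = c \<or> top W = par c"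
      and pc: "top W \<noteq> r \<Longrightarrow> c = top W"
    proof (cases "top W = r")
      case False
      then show ?thesis using that[of "top W"] top[OF W(1)] by (auto simp: subtree_top_def)
    next
      case True
      obtain c0 where c0: "c0 \<in> verts T - {r}" using r' root by auto
      \<comment> \<open>There is no edge above the root, so any edge at the root is taken instead:
        the parent of a non-root vertex of least index must be \<open>r\<close>.\<close>
      define c where "c = arg_min_on idx (verts T - {r})"
      have c: "c \<in> verts T - {r}" unfolding c_def
        using c0 fin by (intro arg_min_if_finite(1)) auto
      have "par c = r"
      proof (rule ccontr)
        assume "par c \<noteq> r"
        then have "par c \<in> verts T - {r}" using c par_in by auto
        then have "\<not> idx (par c) < idx c" unfolding c_def
          using c0 fin arg_min_if_finite(2)[of "verts T - {r}" idx] by auto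
        then show False using idx_par c by auto
      qed
      then show ?thesis using that[of c] c True by auto
    qed
    define \<G>' where "\<G>' = {W' \<in> \<G>. c \<notin> W' \<and> par c \<notin> W'}"
    have WG': "W \<notin> \<G>'" using top[OF W(1)] sc by (auto simp: \<G>'_def subtree_top_def)
    then have "\<G>' \<subset> \<G>" using W(1) by (auto simp: \<G>'_def)
    then have "card \<G>' < card \<G>" using less.prems(1) by (rule psubset_card_mono[rotated])
    moreover have "finite \<G>'" using less.prems(1) by (simp add: \<G>'_def)
    moreover have "\<exists>s. subtree_top W s" if "W \<in> \<G>'" for W
      using less.prems(2) that by (simp add: \<G>'_def)
    ultimately obtain \<W> S where IH: "\<W> \<subseteq> \<G>'" "pairwise (separated T) \<W>" "S \<subseteq> verts T - {r}"
      "card S \<le> card \<W>" "\<forall>W\<in>\<G>'. \<exists>v\<in>S. v \<in> W \<or> par v \<in> W"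
      using less.hyps[of \<G>'] by blast
    have sep: "separated T W W'" if "W' \<in> \<W>" for W'
    proof (rule separated_subtrees[OF top[OF W(1)]])
      have W': "W' \<in> \<G>" "c \<notin> W'" "par c \<notin> W'" using that IH(1) by (auto simp: \<G>'_def)
      show "subtree_top W' (top W')" "idx (top W') \<le> idx (top W)" using W' top W(2) by auto
      show "top W \<notin> W'" "top W \<noteq> r \<Longrightarrow> par (top W) \<notin> W'" using W' sc pc by auto
    qed
    have finW: "finite \<W>" using IH(1) \<open>finite \<G>'\<close> by (rule finite_subset)
    have finS: "finite S" using IH(3) fin by (auto intro: finite_subset)
    show ?thesis
    proof (intro exI conjI)
      show "insert W \<W> \<subseteq> \<G>" using IH(1) W(1) by (auto simp: \<G>'_def)
      show "pairwise (separated T) (insert W \<W>)"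
        using IH(2) sep separated_sym[OF sep] by (simp add: pairwise_insert)
      show "insert c S \<subseteq> verts T - {r}" using IH(3) c by auto
      have "W \<notin> \<W>" using IH(1) WG' by auto
      then show "card (insert c S) \<le> card (insert W \<W>)"
        using IH(4) finW finS by (simp add: card_insert_if)
      show "\<forall>W\<in>\<G>. \<exists>v\<in>insert c S. v \<in> W \<or> par v \<in> W"
        using IH(5) by (auto simp: \<G>'_def)
    qed
  qed
qed

text \<open>\<open>W\<close> is a connected component of the subgraph induced by \<open>Y\<close>,
  and no component has a neighbour in the rest of \<open>Y\<close>. Choosing the vertex
  \<open>s\<close> of least index in \<open>Y\<close> as its top rules out a parent of
  \<open>s\<close> in \<open>Y\<close>.\<close>

lemma component_exists:
  assumes "Y \<subseteq> verts T" "Y \<noteq> {}"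
  shows "\<exists>W s. subtree_top W s \<and> W \<subseteq> Y \<and> boundary T W \<inter> Y = {}"
proof -
  define s where "s = arg_min_on idx Y"
  have finY: "finite Y" using assms fin by (auto intro: finite_subset)
  have s: "s \<in> Y"
    unfolding s_def using arg_min_if_finite(1)[OF finY assms(2)] .
  have smin: "idx s \<le> idx y" if "y \<in> Y" for y
    unfolding s_def using arg_min_least[OF finY assms(2) that] .
  \<comment> \<open>The vertices from which climbing reaches \<open>s\<close> without leaving
    \<open>Y\<close>.\<close>
  define W where "W = {v. (v, s) \<in> {(x, y). x \<in> Y \<and> y \<in> Y \<and> x \<noteq> r \<and> y = par x}\<^sup>*}"
  have sW: "s \<in> W" by (simp add: W_def)
  have WY: "W \<subseteq> Y"
  proof
    fix v assume "v \<in> W"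
    then show "v \<in> Y" unfolding W_def mem_Collect_eq using s by (cases rule: converse_rtranclE) auto
  qed
  have "subtree_top W s" unfolding subtree_top_def
  proof (intro conjI ballI)
    show "W \<subseteq> verts T" using WY assms by auto
    show "s \<in> W" by fact
    fix w assume w: "w \<in> W - {s}"
    then have "(w, s) \<in> {(x, y). x \<in> Y \<and> y \<in> Y \<and> x \<noteq> r \<and> y = par x}\<^sup>*" by (simp add: W_def)
    then show "w \<noteq> r" "par w \<in> W" using w unfolding W_def mem_Collect_eq
      by (cases rule: converse_rtranclE; auto)+
  qed
  moreover have "boundary T W \<inter> Y = {}"
  proof -
    have False if y: "y \<in> boundary T W" "y \<in> Y" for y
    proof -
      obtain x where x: "x \<in> W" "{x, y} \<in> edges T" and yW: "y \<notin> W"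
        using y by (auto simp: boundary_def)
      from edge_cases[OF x(2)] show False
      proof
        assume a: "x \<noteq> r \<and> y = par x \<and> x \<in> verts T"
        show False
        proof (cases "x = s")
          case True
          then show False using smin[OF y(2)] idx_par[of x] a by auto
        next
          case False
          then show False using \<open>subtree_top W s\<close> x a yW by (auto simp: subtree_top_def)
        qed
      next
        assume a: "y \<noteq> r \<and> x = par y \<and> y \<in> verts T"
        then have "(y, s) \<in> {(x, y). x \<in> Y \<and> y \<in> Y \<and> x \<noteq> r \<and> y = par x}\<^sup>*"
          using x(1) WY y(2) unfolding W_def mem_Collect_eq
          by (intro converse_rtrancl_into_rtrancl[of y x]) auto
        then show False using yW by (simp add: W_def)
      qed
    qed
    then show ?thesis by auto
  qed
  ultimately show ?thesis using WY by blast
qed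

end


section \<open>Embeddings, copies and blow-ups\<close>

text \<open>Extensional functions, so that an embedding is determined by its values on
  \<open>verts T\<close> and can be counted.\<close>

definition embs :: "'a ugraph \<Rightarrow> 'b ugraph \<Rightarrow> ('a \<Rightarrow> 'b) set" where
  "embs T G = {f \<in> verts T \<rightarrow>\<^sub>E verts G. inj_on f (verts T) \<and> (\<forall>e\<in>edges T. f ` e \<in> edges G)}"

lemma finite_embs: "finite (verts T) \<Longrightarrow> finite (verts G) \<Longrightarrow> finite (embs T G)"
  unfolding embs_def by (simp add: finite_PiE)

text \<open>\<open>H\<close> is kept apart from \<open>G\<close> because the copy will be placed in
  an induced subgraph of the graph into which \<open>f\<close> embeds.\<close>

lemma emb_image_in_copies:
  assumes T: "fin_simple_graph T" and f: "f \<in> embs T G"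
    and H: "f ` verts T \<subseteq> verts H" "(\<lambda>e. f ` e) ` edges T \<subseteq> edges H"
  shows "(f ` verts T, (\<lambda>e. f ` e) ` edges T) \<in> copies T H"
proof -
  have inj: "inj_on f (verts T)" using f by (simp add: embs_def)
  have "fin_simple_graph (f ` verts T, (\<lambda>e. f ` e) ` edges T)"
    using T inj by (auto simp: fin_simple_graph_def card_image inj_on_subset)
  moreover have "isomorphic T (f ` verts T, (\<lambda>e. f ` e) ` edges T)"
    using inj by (auto simp: isomorphic_def bij_betw_def)
  ultimately show ?thesis using H by (simp add: copies_def subgraph_def)
qed

text \<open>An isomorphism from \<open>T\<close> to a copy, restricted to \<open>verts T\<close>, is
  an embedding whose image is that copy.\<close>

lemma card_copies_le_embs:
  assumes T: "fin_simple_graph T" and G: "fin_simple_graph G"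
  shows "card (copies T G) \<le> card (embs T G)"
proof -
  have "copies T G \<subseteq> (\<lambda>f. (f ` verts T, (\<lambda>e. f ` e) ` edges T)) ` embs T G"
  proof
    fix H assume H: "H \<in> copies T G"
    then obtain f where f: "bij_betw f (verts T) (verts H)" "(\<lambda>e. f ` e) ` edges T = edges H"
      by (auto simp: copies_def isomorphic_def)
    have sub: "verts H \<subseteq> verts G" "edges H \<subseteq> edges G" using H by (auto simp: copies_def subgraph_def)
    let ?g = "restrict f (verts T)"
    have ge: "?g ` e = f ` e" if "e \<in> edges T" for e
      using T that by (auto simp: fin_simple_graph_def)
    have eq: "(\<lambda>e. ?g ` e) ` edges T = edges H" "?g ` verts T = verts H"
      using f ge by (auto simp: bij_betw_def)
    have "?g \<in> embs T G"
      using f ge sub by (auto simp: embs_def bij_betw_def inj_on_def)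
    then show "H \<in> (\<lambda>f. (f ` verts T, (\<lambda>e. f ` e) ` edges T)) ` embs T G"
      using eq by (intro image_eqI[of _ _ ?g]) (auto simp: prod_eq_iff)
  qed
  moreover have "finite (embs T G)" using T G by (intro finite_embs) (auto simp: fin_simple_graph_def)
  ultimately show ?thesis by (meson card_image_le card_mono finite_imageI le_trans)
qed

text \<open>
  The parts are the members of \<open>\<W>\<close>. Since they are separated, replicas of different parts combine
  freely, although \<open>f j\<close> moves all the parts at once.
\<close>

definition blowup :: "'a ugraph \<Rightarrow> 'b ugraph \<Rightarrow> nat \<Rightarrow> 'a set set \<Rightarrow> bool" where
  "blowup T G p \<W> \<longleftrightarrow> \<W> \<subseteq> Pow (verts T) - {{}} \<and> pairwise (separated T) \<W> \<and>
    (\<exists>f. (\<forall>j<p. f j \<in> embs T G) \<and>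
      (\<forall>i<p. \<forall>j<p. \<forall>v\<in>verts T - \<Union>\<W>. f i v = f j v) \<and>
      (\<forall>i<p. \<forall>j<p. i \<noteq> j \<longrightarrow> f i ` \<Union>\<W> \<inter> f j ` \<Union>\<W> = {}))"

lemma blowup_subset: "blowup T G p \<W> \<Longrightarrow> \<W> \<subseteq> Pow (verts T) - {{}}"
  by (simp add: blowup_def)

definition induced :: "'b ugraph \<Rightarrow> 'b set \<Rightarrow> 'b ugraph" where
  "induced G Y = (Y, {e \<in> edges G. e \<subseteq> Y})"

text \<open>A function \<open>c\<close> choosing one of the \<open>p\<close> replicas for each part
  yields an embedding \<open>chi c\<close>, and different choices yield different copies. All of
  them live on the union \<open>X\<close> of the replicas; \<open>Y\<close> is left free above
  \<open>X\<close> so that the host can be cut down to a prescribed order.\<close>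

lemma blowup_copies:
  assumes T: "fin_simple_graph T" and G: "fin_simple_graph G"
    and bl: "blowup T G p \<W>" and p: "p \<ge> 1"
  shows "\<exists>X \<subseteq> verts G. card X \<le> p * card (verts T) \<and>
    (\<forall>Y. X \<subseteq> Y \<longrightarrow> Y \<subseteq> verts G \<longrightarrow> p ^ card \<W> \<le> card (copies T (induced G Y)))"
proof -
  obtain f where f: "\<forall>j<p. f j \<in> embs T G"
    "\<forall>i<p. \<forall>j<p. \<forall>v\<in>verts T - \<Union>\<W>. f i v = f j v"
    "\<forall>i<p. \<forall>j<p. i \<noteq> j \<longrightarrow> f i ` \<Union>\<W> \<inter> f j ` \<Union>\<W> = {}"
    using bl unfolding blowup_def by (elim conjE exE)
  have femb: "f j \<in> embs T G" if "j < p" for j using f(1) that by simp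
  have agree: "f i v = f j v" if "i < p" "j < p" "v \<in> verts T" "v \<notin> \<Union>\<W>" for i j v
    using f(2) that by blast
  have disj: "f i ` \<Union>\<W> \<inter> f j ` \<Union>\<W> = {}" if "i < p" "j < p" "i \<noteq> j" for i j
    using f(3) that by blast
  have Wsub: "\<W> \<subseteq> Pow (verts T) - {{}}" and sep: "pairwise (separated T) \<W>"
    using bl by (auto simp: blowup_def)
  have finT: "finite (verts T)" using T by (simp add: fin_simple_graph_def)
  have finW: "finite \<W>" using Wsub finT by (auto intro: finite_subset)
  have inj: "inj_on (f j) (verts T)" if "j < p" for j using femb[OF that] by (simp add: embs_def)
  define blk where "blk v = (THE W. W \<in> \<W> \<and> v \<in> W)" for v
  have blk: "blk v = W" if "W \<in> \<W>" "v \<in> W" for v W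
    unfolding blk_def
    using that sep by (intro the_equality) (auto simp: pairwise_def separated_def)
  \<comment> \<open>Outside the parts all replicas agree, so the default index 0 is as good as any
    other; it is a legal index because \<open>p \<ge> 1\<close>.\<close>
  define ind where "ind c v = (if v \<in> \<Union>\<W> then c (blk v) else 0)" for c :: "'a set \<Rightarrow> nat" and v
  define chi where "chi c v = f (ind c v) v" for c v
  let ?C = "\<W> \<rightarrow>\<^sub>E {..<p}"
  have ind: "ind c v < p" if "c \<in> ?C" for c v
    using that p blk by (auto simp: ind_def)
  \<comment> \<open>The image of a replicated vertex reveals both the vertex and the replica number.
    This gives injectivity of each \<open>chi c\<close> and later the distinctness of the
    copies.\<close>
  have coincide: "v \<in> \<Union>\<W> \<and> i = j \<and> v = v'"
    if "i < p" "j < p" "v \<in> \<Union>\<W>" "v' \<in> verts T" "f i v = f j v'" for i j v v'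
  proof (cases "v' \<in> \<Union>\<W>")
    case True
    then have "i = j" using disj[OF that(1,2)] that by blast
    then show ?thesis using inj[OF that(1)] that Wsub by (auto simp: inj_on_def)
  next
    case False
    then have "f i v = f i v'" using agree[OF that(1,2,4)] that by simp
    then have "v = v'" using inj[OF that(1)] that Wsub by (auto simp: inj_on_def)
    then show ?thesis using False that by simp
  qed
  define X where "X = (\<Union>j<p. f j ` verts T)"
  have XG: "X \<subseteq> verts G" unfolding X_def using femb by (force simp: embs_def)
  have "card X \<le> (\<Sum>j<p. card (f j ` verts T))" unfolding X_def by (rule card_UN_le) simp
  also have "\<dots> \<le> (\<Sum>j<p. card (verts T))" by (rule sum_mono) (rule card_image_le[OF finT])
  finally have cX: "card X \<le> p * card (verts T)" by simp
  have chi_X: "chi c v \<in> X" if "c \<in> ?C" "v \<in> verts T" for c v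
    unfolding X_def chi_def using ind[OF that(1)] that(2) by auto
  have chi_inj: "inj_on (chi c) (verts T)" if c: "c \<in> ?C" for c
  proof (rule inj_onI)
    fix v v' assume v: "v \<in> verts T" "v' \<in> verts T" and eq: "chi c v = chi c v'"
    consider "v \<in> \<Union>\<W>" | "v' \<in> \<Union>\<W>" | "v \<notin> \<Union>\<W>" "v' \<notin> \<Union>\<W>" by blast
    then show "v = v'"
    proof cases
      case 1
      then show ?thesis using coincide[of "ind c v" "ind c v'" v v'] ind[OF c] v eq
        by (simp add: chi_def)
    next
      case 2
      then show ?thesis using coincide[of "ind c v'" "ind c v" v' v] ind[OF c] v eq
        by (simp add: chi_def)
    next
      case 3
      then have "f 0 v = f 0 v'" using eq by (simp add: chi_def ind_def)
      then show ?thesis using inj[of 0] p v by (auto simp: inj_on_def)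
    qed
  qed
  have chi_edge: "chi c ` e \<in> edges G" if c: "c \<in> ?C" and e: "e \<in> edges T" for c e
  proof -
    have "card e = 2" "e \<subseteq> verts T" using e T by (auto simp: fin_simple_graph_def)
    then obtain x y where xy: "e = {x, y}" "x \<in> verts T" "y \<in> verts T" by (auto simp: card_2_iff)
    \<comment> \<open>Every edge is mapped as by a single replica: its ends cannot lie in different
      parts, as these are separated, and an end outside the parts has the same image under all
      replicas.\<close>
    have "\<exists>j<p. chi c x = f j x \<and> chi c y = f j y"
    proof (cases "x \<in> \<Union>\<W>")
      case False
      then have "chi c x = f (ind c y) x"
        using agree[OF ind[OF c] ind[OF c] xy(2)] by (simp add: chi_def)
      then show ?thesis using ind[OF c] by (auto simp: chi_def)
    next
      case True
      show ?thesis
      proof (cases "y \<in> \<Union>\<W>")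
        case False
        then have "chi c y = f (ind c x) y"
          using agree[OF ind[OF c] ind[OF c] xy(3)] by (simp add: chi_def)
        then show ?thesis using ind[OF c] by (auto simp: chi_def)
      next
        case y: True
        obtain W W' where W: "W \<in> \<W>" "x \<in> W" "W' \<in> \<W>" "y \<in> W'" using True y by blast
        have "W = W'"
        proof (rule ccontr)
          assume "W \<noteq> W'"
          then have "separated T W W'" using sep W by (auto simp: pairwise_def)
          then show False using W e xy by (auto simp: separated_def)
        qed
        then have "ind c x = ind c y"
          unfolding ind_def if_P[OF True] if_P[OF y] blk[OF W(1,2)] blk[OF W(3,4)] by simp
        then show ?thesis using ind[OF c] by (auto simp: chi_def)
      qed
    qed
    then obtain j where "j < p" "chi c ` e = f j ` e" using xy by auto
    then show ?thesis using femb[of j] e by (auto simp: embs_def)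
  qed
  have chi_emb: "restrict (chi c) (verts T) \<in> embs T G" if c: "c \<in> ?C" for c
  proof -
    have "restrict (chi c) (verts T) ` e = chi c ` e" if "e \<in> edges T" for e
      using T that by (auto simp: fin_simple_graph_def)
    then show ?thesis
      using chi_inj[OF c] chi_edge[OF c] chi_X[OF c] XG by (auto simp: embs_def inj_on_def)
  qed
  show ?thesis
  proof (intro exI conjI allI impI)
    show "X \<subseteq> verts G" "card X \<le> p * card (verts T)" by fact+
    fix Y assume Y: "X \<subseteq> Y" "Y \<subseteq> verts G"
    let ?cp = "\<lambda>c. (chi c ` verts T, (\<lambda>e. chi c ` e) ` edges T)"
    have sub: "?cp ` ?C \<subseteq> copies T (induced G Y)"
    proof
      fix H assume "H \<in> ?cp ` ?C"
      then obtain c where c: "c \<in> ?C" and H: "H = ?cp c" by auto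
      let ?g = "restrict (chi c) (verts T)"
      have "?g ` e = chi c ` e" if "e \<in> edges T" for e
        using T that by (auto simp: fin_simple_graph_def)
      then have eq: "(\<lambda>e. ?g ` e) ` edges T = (\<lambda>e. chi c ` e) ` edges T"
        by (rule image_cong[OF refl])
      have eq': "?g ` verts T = chi c ` verts T" by auto
      have "chi c ` verts T \<subseteq> verts (induced G Y)"
        using chi_X[OF c] Y by (auto simp: induced_def)
      moreover have "chi c ` e \<in> edges (induced G Y)" if "e \<in> edges T" for e
      proof -
        have "e \<subseteq> verts T" using T that by (simp add: fin_simple_graph_def)
        then show ?thesis
          using chi_edge[OF c that] chi_X[OF c] Y by (auto simp: induced_def)
      qed
      then have "(\<lambda>e. chi c ` e) ` edges T \<subseteq> edges (induced G Y)" by blast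
      ultimately show "H \<in> copies T (induced G Y)"
        unfolding H
        by (rule emb_image_in_copies[OF T chi_emb[OF c], of "induced G Y", unfolded eq eq'])
    qed
    have injcp: "inj_on ?cp ?C"
    proof (rule inj_onI, rule ccontr)
      fix c c' assume c: "c \<in> ?C" "c' \<in> ?C" and eq: "?cp c = ?cp c'" and ne: "c \<noteq> c'"
      then obtain W where W: "W \<in> \<W>" "c W \<noteq> c' W" by (meson PiE_ext)
      then obtain w where w: "w \<in> W" "w \<in> verts T" using Wsub by auto
      \<comment> \<open>The vertex sets of the two copies already differ: by
        \<open>coincide\<close>, the vertex \<open>chi c w\<close> of the first could lie in the
        second only if \<open>c\<close> and \<open>c'\<close> agreed on \<open>W\<close>.\<close>
      have "chi c w \<in> chi c' ` verts T" using eq w by auto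
      then obtain v where v: "v \<in> verts T" "chi c w = chi c' v" by auto
      have "ind c w = ind c' v \<and> w = v"
        using coincide[of "ind c w" "ind c' v" w v] ind c v W w by (auto simp: chi_def)
      then have "ind c w = ind c' w" by (elim conjE) (simp only:)
      moreover have "w \<in> \<Union>\<W>" using W w by blast
      ultimately have "c (blk w) = c' (blk w)" unfolding ind_def by presburger
      then show False using W w blk[of W w] by simp
    qed
    have "finite (verts (induced G Y))"
      using Y G by (auto simp: induced_def fin_simple_graph_def intro: finite_subset)
    then have "finite (copies T (induced G Y))"
      by (intro finite_subset[OF copies_subset]) simp
    then have "card ?C \<le> card (copies T (induced G Y))"
      using card_mono[OF _ sub] card_image[OF injcp] by simp
    then show "p ^ card \<W> \<le> card (copies T (induced G Y))"
      using finW by (simp add: card_PiE)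
  qed
qed


lemma blowup_mono:
  assumes "blowup T G p \<W>" "p' \<le> p"
  shows "blowup T G p' \<W>"
proof -
  obtain f where f: "\<forall>j<p. f j \<in> embs T G"
    "\<forall>i<p. \<forall>j<p. \<forall>v\<in>verts T - \<Union>\<W>. f i v = f j v"
    "\<forall>i<p. \<forall>j<p. i \<noteq> j \<longrightarrow> f i ` \<Union>\<W> \<inter> f j ` \<Union>\<W> = {}"
    using assms(1) unfolding blowup_def by (elim conjE exE)
  have lt: "j < p" if "j < p'" for j using that assms(2) by simp
  show ?thesis unfolding blowup_def
  proof (intro conjI exI allI impI ballI)
    show "\<W> \<subseteq> Pow (verts T) - {{}}" "pairwise (separated T) \<W>"
      using assms(1) by (simp_all add: blowup_def)
    fix i j assume ij: "i < p'" "j < p'"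
    show "f i \<in> embs T G" using f(1) lt[OF ij(1)] by simp
    show "f i v = f j v" if "v \<in> verts T - \<Union>\<W>" for v
      using f(2)[rule_format, OF lt[OF ij(1)] lt[OF ij(2)] that] .
    show "f i ` \<Union>\<W> \<inter> f j ` \<Union>\<W> = {}" if "i \<noteq> j"
      using f(3)[rule_format, OF lt[OF ij(1)] lt[OF ij(2)] that] .
  qed
qed

section \<open>Movable subtrees and the blow-ups they generate\<close>

text \<open>\<open>W\<close> can be moved to \<open>q\<close> disjoint places. Each
  \<open>g j\<close> embeds all of \<open>T\<close>, but it is tied to \<open>\<phi>\<close> only on
  the boundary of \<open>W\<close>, which is enough to paste its values on \<open>W\<close> into
  \<open>\<phi>\<close>.\<close>

definition good :: "'a ugraph \<Rightarrow> 'b ugraph \<Rightarrow> nat \<Rightarrow> ('a \<Rightarrow> 'b) \<Rightarrow> 'a set \<Rightarrow> bool" where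
  "good T G q \<phi> W \<longleftrightarrow> (\<exists>g. (\<forall>j<q. g j \<in> embs T G) \<and>
    (\<forall>j<q. \<forall>y\<in>boundary T W. g j y = \<phi> y) \<and>
    (\<forall>i<q. \<forall>j<q. i \<noteq> j \<longrightarrow> g i ` W \<inter> g j ` W = {}))"

text \<open>Pigeonhole: an element of \<open>Y\<close> lies in at most one of the \<open>q\<close>
  sets.\<close>

lemma disjoint_family_avoids:
  assumes "finite Y" "card Y < q"
    and disj: "\<And>a b. a < q \<Longrightarrow> b < q \<Longrightarrow> a \<noteq> b \<Longrightarrow> A a \<inter> A b = {}"
  shows "\<exists>a<q. A a \<inter> Y = {}"
proof (rule ccontr)
  assume "\<not> ?thesis"
  then have "\<forall>a. \<exists>y. a < q \<longrightarrow> y \<in> A a \<inter> Y" by blast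
  then obtain y where y: "\<And>a. a < q \<Longrightarrow> y a \<in> A a \<inter> Y" by metis
  have "inj_on y {..<q}"
  proof (rule inj_onI, rule ccontr)
    fix a b assume "a \<in> {..<q}" "b \<in> {..<q}" "y a = y b" "a \<noteq> b"
    then show False using disj[of a b] y[of a] y[of b] by auto
  qed
  moreover have "y ` {..<q} \<subseteq> Y" using y by auto
  ultimately have "card {..<q} \<le> card Y" using card_inj_on_le assms(1) by blast
  then show False using assms(2) by simp
qed

text \<open>Greedy choice: at every stage \<open>X\<close> and the sets already chosen have fewer
  than \<open>q\<close> elements in all, so one of the \<open>q\<close> candidates avoids
  them.\<close>

lemma disjoint_selection:
  fixes A :: "'i \<Rightarrow> nat \<Rightarrow> 'b set"
  assumes "finite I" "finite X" "card X + t * card I < q"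
    and fin: "\<And>i a. i \<in> I \<Longrightarrow> a < q \<Longrightarrow> finite (A i a) \<and> card (A i a) \<le> t"
    and disj: "\<And>i a b. i \<in> I \<Longrightarrow> a < q \<Longrightarrow> b < q \<Longrightarrow> a \<noteq> b \<Longrightarrow> A i a \<inter> A i b = {}"
  shows "\<exists>c. (\<forall>i\<in>I. c i < q \<and> A i (c i) \<inter> X = {}) \<and>
    (\<forall>i\<in>I. \<forall>j\<in>I. i \<noteq> j \<longrightarrow> A i (c i) \<inter> A j (c j) = {})"
  using assms
proof (induction I rule: finite_induct)
  case empty
  then show ?case by simp
next
  case (insert i I)
  have "\<exists>c. (\<forall>i\<in>I. c i < q \<and> A i (c i) \<inter> X = {}) \<and>
    (\<forall>i\<in>I. \<forall>j\<in>I. i \<noteq> j \<longrightarrow> A i (c i) \<inter> A j (c j) = {})"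
  proof (rule insert.IH[OF insert.prems(1)])
    show "card X + t * card I < q" using insert.prems(2) insert.hyps by simp
  qed (use insert.prems(3,4) in auto)
  then obtain c where c: "\<forall>i\<in>I. c i < q \<and> A i (c i) \<inter> X = {}"
    "\<forall>i\<in>I. \<forall>j\<in>I. i \<noteq> j \<longrightarrow> A i (c i) \<inter> A j (c j) = {}"
    by (elim exE conjE)
  define Y where "Y = X \<union> (\<Union>j\<in>I. A j (c j))"
  have finA: "finite (A j (c j)) \<and> card (A j (c j)) \<le> t" if "j \<in> I" for j
    using insert.prems(3)[of j "c j"] c(1) that by simp
  have "card Y \<le> card X + card (\<Union>j\<in>I. A j (c j))" unfolding Y_def by (rule card_Un_le)
  also have "card (\<Union>j\<in>I. A j (c j)) \<le> (\<Sum>j\<in>I. card (A j (c j)))"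
    by (rule card_UN_le[OF insert.hyps(1)])
  also have "\<dots> \<le> (\<Sum>j\<in>I. t)" using finA by (intro sum_mono) simp
  finally have "card Y < q" using insert.prems(2) insert.hyps by (simp add: mult.commute)
  moreover have "finite Y" unfolding Y_def using insert.hyps(1) insert.prems(1) finA by simp
  ultimately have "\<exists>a<q. A i a \<inter> Y = {}"
    by (intro disjoint_family_avoids) (use insert.prems(4) in auto)
  then obtain a where a: "a < q" "A i a \<inter> Y = {}" by blast
  let ?c = "c(i := a)"
  have new: "A i a \<inter> A j (c j) = {}" if "j \<in> I" for j using a(2) that by (auto simp: Y_def)
  have upd: "?c j = c j" if "j \<in> I" for j using that insert.hyps(2) by auto
  show ?case
  proof (intro exI[of _ ?c] conjI ballI impI)
    fix j assume "j \<in> insert i I"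
    then show "?c j < q" "A j (?c j) \<inter> X = {}"
      using a c(1) upd by (auto simp: Y_def)
  next
    fix j k assume jk: "j \<in> insert i I" "k \<in> insert i I" "j \<noteq> k"
    consider "j = i" "k \<in> I" | "k = i" "j \<in> I" | "j \<in> I" "k \<in> I" using jk by blast
    then show "A j (?c j) \<inter> A k (?c k) = {}"
    proof cases
      case 1
      then show ?thesis using new[of k] upd[of k] by simp
    next
      case 2
      then show ?thesis using new[of j] upd[of j] by (simp add: Int_commute)
    next
      case 3
      then show ?thesis using c(2) upd jk(3) by simp
    qed
  qed
qed

text \<open>For each part and each of the \<open>p\<close> replicas select one of the
  \<open>q\<close> places of that part, all disjoint from one another and from the image of
  \<open>\<phi>\<close>, and paste them into \<open>\<phi>\<close>. The bound on \<open>q\<close>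
  counts the image of \<open>\<phi>\<close> and the \<open>card \<W> * p\<close> selected sets, each
  of at most \<open>card (verts T)\<close> vertices.\<close>

lemma blowup_of_good:
  assumes T: "fin_simple_graph T" and phi: "\<phi> \<in> embs T G"
    and W: "\<W> \<subseteq> Pow (verts T) - {{}}" "pairwise (separated T) \<W>"
    and good: "\<And>W. W \<in> \<W> \<Longrightarrow> good T G q \<phi> W"
    and q: "card (verts T) + card (verts T) * (card \<W> * p) < q"
  shows "blowup T G p \<W>"
proof -
  let ?t = "card (verts T)"
  have finT: "finite (verts T)" using T by (simp add: fin_simple_graph_def)
  have finW: "finite \<W>" using W(1) finT by (auto intro: finite_subset)
  have "\<forall>W. \<exists>g. W \<in> \<W> \<longrightarrow> (\<forall>j<q. g j \<in> embs T G) \<and>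
    (\<forall>j<q. \<forall>y\<in>boundary T W. g j y = \<phi> y) \<and>
    (\<forall>i<q. \<forall>j<q. i \<noteq> j \<longrightarrow> g i ` W \<inter> g j ` W = {})"
    using good unfolding good_def by blast
  from choice[OF this] obtain g where g: "\<forall>W. W \<in> \<W> \<longrightarrow> (\<forall>j<q. g W j \<in> embs T G) \<and>
    (\<forall>j<q. \<forall>y\<in>boundary T W. g W j y = \<phi> y) \<and>
    (\<forall>i<q. \<forall>j<q. i \<noteq> j \<longrightarrow> g W i ` W \<inter> g W j ` W = {})" ..
  have gemb: "g W j \<in> embs T G" and gbd: "y \<in> boundary T W \<Longrightarrow> g W j y = \<phi> y"
    if "W \<in> \<W>" "j < q" for W j y
    using g that by blast+
  have gdisj: "g W i ` W \<inter> g W j ` W = {}" if "W \<in> \<W>" "i < q" "j < q" "i \<noteq> j" for W i j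
    using g that by blast
  \<comment> \<open>One selection for all pairs of a part and a replica number, so that replicas of
    different parts are disjoint as well.\<close>
  let ?I = "\<W> \<times> {..<p}"
  have "\<exists>c. (\<forall>i\<in>?I. c i < q \<and> g (fst i) (c i) ` fst i \<inter> \<phi> ` verts T = {}) \<and>
    (\<forall>i\<in>?I. \<forall>j\<in>?I. i \<noteq> j \<longrightarrow> g (fst i) (c i) ` fst i \<inter> g (fst j) (c j) ` fst j = {})"
  proof (rule disjoint_selection[where t = ?t])
    show "finite ?I" using finW by simp
    show "finite (\<phi> ` verts T)" using finT by simp
    have "card (\<phi> ` verts T) \<le> ?t" by (rule card_image_le[OF finT])
    then show "card (\<phi> ` verts T) + ?t * card ?I < q"
      using q by (simp add: card_cartesian_product)
    fix i a assume i: "i \<in> ?I"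
    then have "fst i \<in> \<W>" by auto
    then have sub: "fst i \<subseteq> verts T" using W(1) by blast
    then have f: "finite (fst i)" using finT by (rule finite_subset)
    have "card (g (fst i) a ` fst i) \<le> card (fst i)" using f by (rule card_image_le)
    also have "\<dots> \<le> ?t" using finT sub by (rule card_mono)
    finally show "finite (g (fst i) a ` fst i) \<and> card (g (fst i) a ` fst i) \<le> ?t" using f by simp
  next
    fix i a b assume "i \<in> ?I" "a < q" "b < q" "a \<noteq> b"
    then show "g (fst i) a ` fst i \<inter> g (fst i) b ` fst i = {}" by (intro gdisj) auto
  qed
  then obtain c where c: "\<forall>i\<in>?I. c i < q \<and> g (fst i) (c i) ` fst i \<inter> \<phi> ` verts T = {}"
    "\<forall>i\<in>?I. \<forall>j\<in>?I. i \<noteq> j \<longrightarrow> g (fst i) (c i) ` fst i \<inter> g (fst j) (c j) ` fst j = {}"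
    by (elim exE conjE)
  have cq: "c (W, j) < q" if "W \<in> \<W>" "j < p" for W j using c(1) that by force
  have cX: "g W (c (W, j)) x \<noteq> \<phi> y" if "W \<in> \<W>" "j < p" "x \<in> W" "y \<in> verts T" for W j x y
  proof -
    have "g W (c (W, j)) ` W \<inter> \<phi> ` verts T = {}" using bspec[OF c(1), of "(W, j)"] that by simp
    then show ?thesis using that by blast
  qed
  have cd: "g W (c (W, j)) x \<noteq> g W' (c (W', j')) x'"
    if "W \<in> \<W>" "j < p" "x \<in> W" "W' \<in> \<W>" "j' < p" "x' \<in> W'" "(W, j) \<noteq> (W', j')" for W j x W' j' x'
  proof -
    have "g W (c (W, j)) ` W \<inter> g W' (c (W', j')) ` W' = {}"
      using bspec[OF bspec[OF c(2), of "(W, j)"], of "(W', j')"] that by simp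
    then show ?thesis using that by blast
  qed
  define blk where "blk v = (THE W. W \<in> \<W> \<and> v \<in> W)" for v
  have blk: "blk v = W" if "W \<in> \<W>" "v \<in> W" for v W
    unfolding blk_def
    using that W(2) by (intro the_equality) (auto simp: pairwise_def separated_def)
  define f where "f j v = (if v \<in> \<Union>\<W> then g (blk v) (c (blk v, j)) v else \<phi> v)" for j v
  have f_in: "f j v = g W (c (W, j)) v" if "W \<in> \<W>" "v \<in> W" for j v W
  proof -
    have "v \<in> \<Union>\<W>" using that by blast
    then show ?thesis unfolding f_def blk[OF that] by simp
  qed
  have f_out: "f j v = \<phi> v" if "v \<notin> \<Union>\<W>" for j v
    using that by (simp add: f_def)
  have W_ne: "x \<notin> W'" if "W \<in> \<W>" "W' \<in> \<W>" "x \<in> W" "W \<noteq> W'" for W W' x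
    using that blk by blast
  have femb: "f j \<in> embs T G" if j: "j < p" for j
    unfolding embs_def
  proof (intro CollectI conjI ballI)
    show "f j \<in> verts T \<rightarrow>\<^sub>E verts G"
    proof (rule PiE_I)
      fix v assume v: "v \<in> verts T"
      show "f j v \<in> verts G"
      proof (cases "v \<in> \<Union>\<W>")
        case True
        then obtain W where "W \<in> \<W>" "v \<in> W" by blast
        then show ?thesis using gemb[OF _ cq[OF _ j]] v by (auto simp: f_in embs_def)
      next
        case False
        then show ?thesis using phi v by (auto simp: f_out embs_def)
      qed
    next
      fix v assume v: "v \<notin> verts T"
      then have "v \<notin> \<Union>\<W>" using W(1) by blast
      then show "f j v = undefined" using phi v by (auto simp: f_out embs_def)
    qed
  next
    show "inj_on (f j) (verts T)"
    proof (rule inj_onI)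
      fix v v' assume v: "v \<in> verts T" "v' \<in> verts T" and eq: "f j v = f j v'"
      consider W W' where "W \<in> \<W>" "v \<in> W" "W' \<in> \<W>" "v' \<in> W'"
        | W where "W \<in> \<W>" "v \<in> W" "v' \<notin> \<Union>\<W>"
        | W where "W \<in> \<W>" "v' \<in> W" "v \<notin> \<Union>\<W>"
        | "v \<notin> \<Union>\<W>" "v' \<notin> \<Union>\<W>" by blast
      then show "v = v'"
      proof cases
        case 1
        then have "W = W'" using cd[of W j v W' j v'] eq j by (auto simp: f_in)
        moreover have "inj_on (g W (c (W, j))) (verts T)"
          using gemb[OF 1(1) cq[OF 1(1) j]] by (simp add: embs_def)
        ultimately show ?thesis using eq v 1 by (auto simp: f_in inj_on_def)
      next
        case 2
        then show ?thesis using cX[OF 2(1) j 2(2) v(2)] eq by (simp add: f_in f_out)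
      next
        case 3
        then show ?thesis using cX[OF 3(1) j 3(2) v(1)] eq by (simp add: f_in f_out)
      next
        case 4
        then show ?thesis using phi eq v by (auto simp: f_out embs_def inj_on_def)
      qed
    qed
  next
    fix e assume e: "e \<in> edges T"
    have "card e = 2" "e \<subseteq> verts T" using e T by (auto simp: fin_simple_graph_def)
    then obtain x y where xy: "e = {x, y}" "x \<in> verts T" "y \<in> verts T" by (auto simp: card_2_iff)
    \<comment> \<open>An edge meeting \<open>W\<close> has its other end in \<open>W\<close> or in
      the boundary of \<open>W\<close>. In the latter case separation puts that end outside all
      parts, where \<open>f j\<close> is \<open>\<phi>\<close> and agrees with the chosen embedding
      for \<open>W\<close>.\<close>
    have half: "f j ` e \<in> edges G" if W': "W \<in> \<W>" "a \<in> W" and ab: "e = {a, b}" "b \<in> verts T" for W a b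
    proof -
      have "f j b = g W (c (W, j)) b"
      proof (cases "b \<in> W")
        case True
        then show ?thesis using W' f_in by blast
      next
        case False
        have "b \<notin> \<Union>\<W>"
        proof
          assume "b \<in> \<Union>\<W>"
          then obtain W'' where W'': "W'' \<in> \<W>" "b \<in> W''" by blast
          then have "separated T W W''" using W(2) W' False by (auto simp: pairwise_def)
          then show False using W' W'' ab e by (auto simp: separated_def)
        qed
        moreover have "b \<in> boundary T W" using W' False ab e by (auto simp: boundary_def)
        ultimately show ?thesis using gbd[OF W'(1) cq[OF W'(1) j]] by (simp add: f_out)
      qed
      then have "f j ` e = g W (c (W, j)) ` e" using W' ab f_in by simp
      then show ?thesis using gemb[OF W'(1) cq[OF W'(1) j]] e by (simp add: embs_def)
    qed
    consider W where "W \<in> \<W>" "x \<in> W" | W where "W \<in> \<W>" "y \<in> W" | "x \<notin> \<Union>\<W>" "y \<notin> \<Union>\<W>" by blast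
    then show "f j ` e \<in> edges G"
    proof cases
      case 1
      then show ?thesis using half xy by blast
    next
      case 2
      have "e = {y, x}" using xy by auto
      then show ?thesis using half[OF 2] xy by blast
    next
      case 3
      then have "f j ` e = \<phi> ` e" using xy by (simp add: f_out)
      then show ?thesis using phi e by (simp add: embs_def)
    qed
  qed
  show ?thesis unfolding blowup_def
  proof (intro conjI exI allI impI ballI)
    show "\<W> \<subseteq> Pow (verts T) - {{}}" "pairwise (separated T) \<W>" by fact+
    show "f j \<in> embs T G" if "j < p" for j using femb[OF that] .
    show "f i v = f j v" if "v \<in> verts T - \<Union>\<W>" for i j v using that by (simp add: f_out)
    fix i j assume ij: "i < p" "j < p" "i \<noteq> j"
    have "f i x \<noteq> f j y" if xy: "x \<in> \<Union>\<W>" "y \<in> \<Union>\<W>" for x y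
    proof -
      obtain W W' where "W \<in> \<W>" "x \<in> W" "W' \<in> \<W>" "y \<in> W'" using xy by blast
      then show ?thesis using cd[of W i x W' j y] ij by (simp add: f_in)
    qed
    then show "f i ` \<Union>\<W> \<inter> f j ` \<Union>\<W> = {}" by blast
  qed
qed

section \<open>A sunflower lemma for functions\<close>

text \<open>The factor in the recursion bounds the number of pairs of an argument and a value among
  which the induction pigeonholes.\<close>

fun sunflower_bound :: "nat \<Rightarrow> nat \<Rightarrow> nat" where
  "sunflower_bound q 0 = 1"
| "sunflower_bound q (Suc s) = Suc s * (q * Suc s) * sunflower_bound q s"

text \<open>The core is a set of arguments on which all members agree; on its complement
  \<open>Z\<close> in \<open>Y\<close> their images are disjoint. If \<open>q\<close> members have
  disjoint images of \<open>Y\<close>, then \<open>Z = Y\<close> works. Otherwise every member takes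
  a value of a maximal disjoint family, so many members share one value at one argument, which is
  then dropped from \<open>Y\<close>.\<close>

lemma function_sunflower:
  fixes \<Phi> :: "('a \<Rightarrow> 'b) set"
  assumes "finite Y" "finite \<Phi>" "sunflower_bound q (card Y) < card \<Phi>"
    and "\<And>f g v. f \<in> \<Phi> \<Longrightarrow> g \<in> \<Phi> \<Longrightarrow> v \<notin> Y \<Longrightarrow> f v = g v"
  shows "\<exists>Z g. Z \<subseteq> Y \<and> Z \<noteq> {} \<and> (\<forall>j<q. g j \<in> \<Phi>) \<and> (\<forall>i<q. \<forall>j<q. \<forall>v. v \<notin> Z \<longrightarrow> g i v = g j v) \<and>
    (\<forall>i<q. \<forall>j<q. i \<noteq> j \<longrightarrow> g i ` Z \<inter> g j ` Z = {})"
  using assms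
proof (induction "card Y" arbitrary: Y \<Phi>)
  case 0
  then have "Y = {}" by simp
  then have "f = g" if "f \<in> \<Phi>" "g \<in> \<Phi>" for f g
    using 0(5)[OF that] by auto
  then have "card \<Phi> \<le> 1" using 0(3) by (metis One_nat_def card_le_Suc0_iff_eq)
  then show ?case using 0(4) \<open>Y = {}\<close> by simp
next
  case (Suc s)
  let ?P = "\<lambda>n g. (\<forall>j<n. g j \<in> \<Phi>) \<and> (\<forall>i<n. \<forall>j<n. i \<noteq> j \<longrightarrow> g i ` Y \<inter> g j ` Y = {})"
  have "Y \<noteq> {}" using Suc.hyps(2) by auto
  show ?case
  proof (cases "\<exists>g :: nat \<Rightarrow> 'a \<Rightarrow> 'b. ?P q g")
    case True
    then obtain g :: "nat \<Rightarrow> 'a \<Rightarrow> 'b" where g: "?P q g" ..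
    have "g i v = g j v" if "i < q" "j < q" "v \<notin> Y" for i j v
      using g that Suc.prems(4)[of "g i" "g j" v] by blast
    then show ?thesis using g \<open>Y \<noteq> {}\<close> by (intro exI[of _ Y] exI[of _ g]) blast
  next
    case False
    \<comment> \<open>A disjoint family that cannot be extended, of size
      \<open>n < q\<close>.\<close>
    have "\<exists>n<q. (\<exists>g :: nat \<Rightarrow> 'a \<Rightarrow> 'b. ?P n g) \<and> \<not> (\<exists>g :: nat \<Rightarrow> 'a \<Rightarrow> 'b. ?P (Suc n) g)"
    proof (rule ccontr)
      assume neg: "\<not> ?thesis"
      have "n \<le> q \<Longrightarrow> \<exists>g :: nat \<Rightarrow> 'a \<Rightarrow> 'b. ?P n g" for n
      proof (induction n)
        case (Suc n)
        then have "n < q" "\<exists>g :: nat \<Rightarrow> 'a \<Rightarrow> 'b. ?P n g" by simp_all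
        then show ?case using neg by blast
      qed simp
      then show False using False by blast
    qed
    then obtain n where n': "n < q \<and> (\<exists>g :: nat \<Rightarrow> 'a \<Rightarrow> 'b. ?P n g) \<and>
        \<not> (\<exists>g :: nat \<Rightarrow> 'a \<Rightarrow> 'b. ?P (Suc n) g)" ..
    then obtain g :: "nat \<Rightarrow> 'a \<Rightarrow> 'b" where "?P n g" by (elim conjE[of "n < q"]) blast
    with n' have n: "n < q" "?P n g" "\<not> (\<exists>g :: nat \<Rightarrow> 'a \<Rightarrow> 'b. ?P (Suc n) g)" by simp_all
    define Z where "Z = (\<Union>j<n. g j ` Y)"
    have finZ: "finite Z" using Suc.prems(1) by (simp add: Z_def)
    have "card Z \<le> (\<Sum>j<n. card (g j ` Y))" unfolding Z_def by (rule card_UN_le) simp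
    also have "\<dots> \<le> (\<Sum>j<n. card Y)" by (rule sum_mono) (rule card_image_le[OF Suc.prems(1)])
    also have "\<dots> \<le> q * card Y" using n(1) by simp
    finally have cZ: "card Z \<le> q * Suc s" using Suc.hyps(2) by simp
    have meets: "\<exists>y\<in>Y. f y \<in> Z" if f: "f \<in> \<Phi>" for f
    proof (rule ccontr)
      assume no: "\<not> ?thesis"
      have fg: "f ` Y \<inter> g j ` Y = {}" if "j < n" for j using no that by (auto simp: Z_def)
      have "?P (Suc n) (g(n := f))"
      proof (intro conjI allI impI)
        fix j assume "j < Suc n"
        then show "(g(n := f)) j \<in> \<Phi>" using n(2) f by (cases "j = n") simp_all
      next
        fix i j assume ij: "i < Suc n" "j < Suc n" "i \<noteq> j"
        consider "i = n" "j < n" | "j = n" "i < n" | "i < n" "j < n" using ij by linarith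
        then show "(g(n := f)) i ` Y \<inter> (g(n := f)) j ` Y = {}"
        proof cases
          case 1
          then show ?thesis using fg[of j] by simp
        next
          case 2
          then show ?thesis using fg[of i] by (simp add: Int_commute)
        next
          case 3
          then show ?thesis using n(2) ij by simp
        qed
      qed
      then show False using n(3) by blast
    qed
    \<comment> \<open>Classes of members sharing the value \<open>z\<close> at \<open>y\<close>. By
      \<open>meets\<close> the classes with \<open>y \<in> Y\<close> and \<open>z \<in> Z\<close>
      cover \<open>\<Phi>\<close>, so one of them is large enough for the induction
      hypothesis.\<close>
    define F where "F = (\<lambda>(y, z). {f \<in> \<Phi>. f y = z})"
    have "\<exists>yz\<in>Y \<times> Z. sunflower_bound q s < card (F yz)"
    proof (rule ccontr)
      assume "\<not> ?thesis"
      then have le: "card (F yz) \<le> sunflower_bound q s" if "yz \<in> Y \<times> Z" for yz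
        using that by (meson not_le)
      have "\<Phi> \<subseteq> (\<Union>yz\<in>Y \<times> Z. F yz)"
      proof
        fix f assume f: "f \<in> \<Phi>"
        then obtain y where "y \<in> Y" "f y \<in> Z" using meets by blast
        then show "f \<in> (\<Union>yz\<in>Y \<times> Z. F yz)" using f
          by (intro UN_I[of "(y, f y)"]) (auto simp: F_def)
      qed
      moreover have "finite (\<Union>yz\<in>Y \<times> Z. F yz)"
        using Suc.prems(2) by (rule rev_finite_subset) (auto simp: F_def)
      ultimately have "card \<Phi> \<le> card (\<Union>yz\<in>Y \<times> Z. F yz)" by (intro card_mono)
      also have "\<dots> \<le> (\<Sum>yz\<in>Y \<times> Z. card (F yz))"
        using Suc.prems(1) finZ by (intro card_UN_le) simp
      also have "\<dots> \<le> (\<Sum>yz\<in>Y \<times> Z. sunflower_bound q s)" by (rule sum_mono) (rule le)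
      also have "\<dots> = Suc s * card Z * sunflower_bound q s"
        using Suc.hyps(2) by (simp add: card_cartesian_product)
      also have "\<dots> \<le> Suc s * (q * Suc s) * sunflower_bound q s"
        by (intro mult_le_mono order_refl cZ)
      finally show False using Suc.prems(3) Suc.hyps(2)[symmetric] by simp
    qed
    then obtain y z where yz: "y \<in> Y" "sunflower_bound q s < card (F (y, z))" by auto
    have FP: "F (y, z) \<subseteq> \<Phi>" by (auto simp: F_def)
    have cY: "s = card (Y - {y})" using Suc.hyps(2) yz Suc.prems(1) by simp
    have "\<exists>Z' g. Z' \<subseteq> Y - {y} \<and> Z' \<noteq> {} \<and> (\<forall>j<q. g j \<in> F (y, z)) \<and>
      (\<forall>i<q. \<forall>j<q. \<forall>v. v \<notin> Z' \<longrightarrow> g i v = g j v) \<and>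
      (\<forall>i<q. \<forall>j<q. i \<noteq> j \<longrightarrow> g i ` Z' \<inter> g j ` Z' = {})"
    proof (rule Suc.hyps(1)[OF cY])
      show "finite (Y - {y})" using Suc.prems(1) by simp
      show "finite (F (y, z))" using FP Suc.prems(2) by (rule finite_subset)
      show "sunflower_bound q (card (Y - {y})) < card (F (y, z))" using yz cY by simp
      fix f h v assume "f \<in> F (y, z)" "h \<in> F (y, z)" "v \<notin> Y - {y}"
      then show "f v = h v" using Suc.prems(4)[of f h v] by (cases "v = y") (auto simp: F_def)
    qed
    then obtain Z' g where Z': "Z' \<subseteq> Y - {y}" "Z' \<noteq> {}" "\<forall>j<q. g j \<in> F (y, z)"
      "\<forall>i<q. \<forall>j<q. \<forall>v. v \<notin> Z' \<longrightarrow> g i v = g j v"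
      "\<forall>i<q. \<forall>j<q. i \<noteq> j \<longrightarrow> g i ` Z' \<inter> g j ` Z' = {}" by (elim exE conjE)
    show ?thesis
    proof (intro exI conjI)
      show "Z' \<subseteq> Y" "\<forall>j<q. g j \<in> \<Phi>" using Z'(1,3) FP by blast+
    qed (fact Z')+
  qed
qed


section \<open>Counting embeddings into hosts with few edges\<close>

lemma card_ordered_edges:
  assumes "finite (edges G)"
  shows "finite {(a, b). {a, b} \<in> edges G}" "card {(a, b). {a, b} \<in> edges G} \<le> 2 * card (edges G)"
proof -
  have pair: "finite {(a, b). {a, b} = e} \<and> card {(a, b). {a, b} = e} \<le> 2" for e :: "'b set"
  proof (cases "\<exists>x y. e = {x, y}")
    case True
    then obtain x y where e: "e = {x, y}" by blast
    have sub: "{(a, b). {a, b} = e} \<subseteq> {(x, y), (y, x)}"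
    proof
      fix ab assume "ab \<in> {(a, b). {a, b} = e}"
      then obtain a b where "ab = (a, b)" "{a, b} = {x, y}" unfolding e by blast
      then show "ab \<in> {(x, y), (y, x)}" unfolding doubleton_eq_iff by blast
    qed
    have "card {(x, y), (y, x)} \<le> 2"
      using card_length[of "[(x, y), (y, x)]"] by simp
    then have "card {(a, b). {a, b} = e} \<le> 2" by (intro le_trans[OF card_mono[OF _ sub]]) simp_all
    moreover have "finite {(a, b). {a, b} = e}" by (rule finite_subset[OF sub]) simp
    ultimately show ?thesis by blast
  next
    case False
    then have "{(a, b). {a, b} = e} = {}" by auto
    then show ?thesis by simp
  qed
  have eq: "{(a, b). {a, b} \<in> edges G} = (\<Union>e\<in>edges G. {(a, b). {a, b} = e})"
    by (rule set_eqI) (simp add: split_beta)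
  show "finite {(a, b). {a, b} \<in> edges G}" unfolding eq by (rule finite_UN_I[OF assms conjunct1[OF pair]])
  have "card {(a, b). {a, b} \<in> edges G} \<le> (\<Sum>e\<in>edges G. card {(a, b). {a, b} = e})"
    unfolding eq by (rule card_UN_le[OF assms])
  also have "\<dots> \<le> (\<Sum>e\<in>edges G. 2)" using pair by (intro sum_mono) blast
  finally show "card {(a, b). {a, b} \<in> edges G} \<le> 2 * card (edges G)" by simp
qed

text \<open>The boundary of a component of \<open>Z\<close> avoids \<open>Z\<close>, where all
  \<open>g j\<close> agree; hence the sunflower itself witnesses that the component is
  movable.\<close>

lemma (in rooted_tree) petals_good_component:
  assumes Z: "Z \<subseteq> verts T" "Z \<noteq> {}" and q: "0 < q"
    and g: "\<forall>j<q. g j \<in> embs T G" "\<forall>i<q. \<forall>j<q. \<forall>v. v \<notin> Z \<longrightarrow> g i v = g j v"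
      "\<forall>i<q. \<forall>j<q. i \<noteq> j \<longrightarrow> g i ` Z \<inter> g j ` Z = {}"
  shows "\<exists>W s. subtree_top W s \<and> W \<subseteq> Z \<and> good T G q (g 0) W"
proof -
  obtain W s where W: "subtree_top W s" "W \<subseteq> Z" "boundary T W \<inter> Z = {}"
    using component_exists[OF Z] by (elim exE conjE)
  have "good T G q (g 0) W" unfolding good_def
  proof (intro exI[of _ g] conjI allI impI ballI)
    fix j y assume "j < q" "y \<in> boundary T W"
    moreover have "y \<notin> Z" using W(3) \<open>y \<in> boundary T W\<close> by blast
    ultimately show "g j y = g 0 y" using g(2) q by blast
  next
    fix i j assume "i < q" "j < q" "i \<noteq> j"
    then have "g i ` Z \<inter> g j ` Z = {}" using g(3) by blast
    then show "g i ` W \<inter> g j ` W = {}" using W(2) by blast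
  qed (use g(1) in blast)
  then show ?thesis using W by blast
qed

text \<open>Each embedding is encoded by at most \<open>m\<close> edges of \<open>T\<close> hitting
  all its movable subtrees, together with their images. There are at most
  \<open>2 ^ card (verts T) * M ^ m\<close> codes, and a sunflower among embeddings with equal code
  would give a movable subtree missed by these edges.\<close>

lemma (in rooted_tree) card_embs_bound:
  fixes G :: "'b ugraph"
  assumes T: "fin_simple_graph T" and G: "fin_simple_graph G" and ne: "verts T \<noteq> {r}"
    and nb: "\<And>\<W>. card \<W> = Suc m \<Longrightarrow> \<not> blowup T G p \<W>"
    and q: "q = Suc (card (verts T) + card (verts T) * (Suc m * p))"
    and M: "2 * card (edges G) \<le> M" "1 \<le> M"
  shows "card (embs T G) \<le> 2 ^ card (verts T) * M ^ m * sunflower_bound q (card (verts T))"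
proof -
  let ?t = "card (verts T)"
  define A where "A = {(a, b). {a, b} \<in> edges G}"
  have "finite (edges G)"
  proof (rule finite_subset)
    show "edges G \<subseteq> Pow (verts G)" using G by (auto simp: fin_simple_graph_def)
  qed (use G in \<open>simp add: fin_simple_graph_def\<close>)
  then have finA: "finite A" and cA: "card A \<le> M"
    using card_ordered_edges[of G] M(1) by (simp_all add: A_def)
  have "0 < ?t" using root fin by (auto simp: card_gt_0_iff)
  then have q2: "1 < q" using q by simp
  define \<G> where "\<G> \<phi> = {W. (\<exists>s. subtree_top W s) \<and> good T G q \<phi> W}" for \<phi>
  have Gsub: "\<G> \<phi> \<subseteq> Pow (verts T) - {{}}" for \<phi>
    by (auto simp: \<G>_def subtree_top_def)
  have ex: "\<exists>S. S \<subseteq> verts T - {r} \<and> card S \<le> m \<and> (\<forall>W\<in>\<G> \<phi>. \<exists>v\<in>S. v \<in> W \<or> par v \<in> W)"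
    if phi: "\<phi> \<in> embs T G" for \<phi>
  proof -
    have finG: "finite (\<G> \<phi>)" by (rule finite_subset[OF Gsub]) (simp add: fin)
    obtain \<W> S where WS: "\<W> \<subseteq> \<G> \<phi>" "pairwise (separated T) \<W>" "S \<subseteq> verts T - {r}"
      "card S \<le> card \<W>" "\<forall>W\<in>\<G> \<phi>. \<exists>v\<in>S. v \<in> W \<or> par v \<in> W"
      using subtree_hitting[OF finG _ ne] by (auto simp: \<G>_def)
    \<comment> \<open>More than \<open>m\<close> separated movable subtrees would produce a
      forbidden blow-up; \<open>q\<close> is large enough for \<open>Suc m\<close> parts with
      \<open>p\<close> replicas.\<close>
    have "card \<W> \<le> m"
    proof (rule ccontr)
      assume "\<not> card \<W> \<le> m"
      then obtain \<W>' where W': "\<W>' \<subseteq> \<W>" "card \<W>' = Suc m"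
        by (meson not_less_eq_eq obtain_subset_with_card_n)
      have "blowup T G p \<W>'"
      proof (rule blowup_of_good[OF T phi, where q = q])
        show "\<W>' \<subseteq> Pow (verts T) - {{}}" using W' WS(1) Gsub by blast
        show "pairwise (separated T) \<W>'" using WS(2) W'(1) by (rule pairwise_subset)
        show "good T G q \<phi> W" if "W \<in> \<W>'" for W using that W' WS(1) by (auto simp: \<G>_def)
        show "?t + ?t * (card \<W>' * p) < q" unfolding W'(2) q by simp
      qed
      then show False using nb W' by blast
    qed
    then show ?thesis using WS by (intro exI[of _ S]) auto
  qed
  define S where "S \<phi> = (SOME S. S \<subseteq> verts T - {r} \<and> card S \<le> m \<and>
    (\<forall>W\<in>\<G> \<phi>. \<exists>v\<in>S. v \<in> W \<or> par v \<in> W))" for \<phi>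
  have S: "S \<phi> \<subseteq> verts T - {r} \<and> card (S \<phi>) \<le> m \<and> (\<forall>W\<in>\<G> \<phi>. \<exists>v\<in>S \<phi>. v \<in> W \<or> par v \<in> W)"
    if "\<phi> \<in> embs T G" for \<phi>
    unfolding S_def using ex[OF that] by (rule someI_ex)
  \<comment> \<open>A vertex \<open>v\<close> of the hitting set stands for the edge to its parent,
    whose image is recorded as an ordered pair of adjacent vertices.\<close>
  define key where "key \<phi> = (S \<phi>, \<lambda>v\<in>S \<phi>. (\<phi> v, \<phi> (par v)))" for \<phi> :: "'a \<Rightarrow> 'b"
  let ?\<S> = "{S. S \<subseteq> verts T - {r} \<and> card S \<le> m}"
  let ?K = "SIGMA S:?\<S>. S \<rightarrow>\<^sub>E A"
  have finS: "finite ?\<S>" by (rule finite_subset[of _ "Pow (verts T)"]) (use fin in auto)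
  have fin1: "finite S" if "S \<in> ?\<S>" for S using that fin by (auto intro: finite_subset)
  have finK: "finite ?K" by (rule finite_SigmaI[OF finS]) (rule finite_PiE[OF fin1 finA])
  have "card ?K = (\<Sum>S\<in>?\<S>. card (S \<rightarrow>\<^sub>E A))"
    by (rule card_SigmaI[OF finS]) (use fin1 finA in \<open>simp add: finite_PiE\<close>)
  also have "\<dots> \<le> (\<Sum>S\<in>?\<S>. M ^ m)"
  proof (rule sum_mono)
    fix S assume S: "S \<in> ?\<S>"
    have "card (S \<rightarrow>\<^sub>E A) = card A ^ card S" using fin1[OF S] by (simp add: card_PiE)
    also have "\<dots> \<le> M ^ card S" using cA by (rule power_mono) simp
    \<comment> \<open>The hitting set may have fewer than \<open>m\<close> elements;
      \<open>1 \<le> M\<close> allows the exponent to be raised.\<close>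
    also have "\<dots> \<le> M ^ m" using S M(2) by (intro power_increasing) auto
    finally show "card (S \<rightarrow>\<^sub>E A) \<le> M ^ m" .
  qed
  also have "\<dots> = card ?\<S> * M ^ m" by simp
  also have "\<dots> \<le> 2 ^ ?t * M ^ m"
  proof (rule mult_le_mono1)
    have "card ?\<S> \<le> card (Pow (verts T))" by (rule card_mono) (use fin in auto)
    then show "card ?\<S> \<le> 2 ^ ?t" using fin by (simp add: card_Pow)
  qed
  finally have cK: "card ?K \<le> 2 ^ ?t * M ^ m" .
  have keyK: "key \<phi> \<in> ?K" if phi: "\<phi> \<in> embs T G" for \<phi>
  proof -
    have "(\<phi> v, \<phi> (par v)) \<in> A" if "v \<in> S \<phi>" for v
    proof -
      have "{v, par v} \<in> edges T" using S[OF phi] that by (auto simp: edges_eq)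
      then have "\<phi> ` {v, par v} \<in> edges G" using phi unfolding embs_def by blast
      then show ?thesis by (simp add: A_def)
    qed
    then show ?thesis using S[OF phi] by (auto simp: key_def)
  qed
  have finE: "finite (embs T G)" using G by (intro finite_embs fin) (simp add: fin_simple_graph_def)
  have fibre: "card {\<phi> \<in> embs T G. key \<phi> = k} \<le> sunflower_bound q ?t" for k
  proof (rule ccontr)
    assume "\<not> ?thesis"
    then have big: "sunflower_bound q ?t < card {\<phi> \<in> embs T G. key \<phi> = k}" by simp
    have "\<exists>Z g. Z \<subseteq> verts T \<and> Z \<noteq> {} \<and> (\<forall>j<q. g j \<in> {\<phi> \<in> embs T G. key \<phi> = k}) \<and>
      (\<forall>i<q. \<forall>j<q. \<forall>v. v \<notin> Z \<longrightarrow> g i v = g j v) \<and>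
      (\<forall>i<q. \<forall>j<q. i \<noteq> j \<longrightarrow> g i ` Z \<inter> g j ` Z = {})"
    proof (rule function_sunflower[OF fin _ big])
      show "finite {\<phi> \<in> embs T G. key \<phi> = k}" using finE by simp
      fix f h v assume "f \<in> {\<phi> \<in> embs T G. key \<phi> = k}" "h \<in> {\<phi> \<in> embs T G. key \<phi> = k}" "v \<notin> verts T"
      then have "f v = undefined" "h v = undefined" by (auto simp: embs_def)
      then show "f v = h v" by simp
    qed
    then obtain Z g where Z: "Z \<subseteq> verts T" "Z \<noteq> {}"
      and g0: "\<forall>j<q. g j \<in> {\<phi> \<in> embs T G. key \<phi> = k}"
      and g1: "\<forall>i<q. \<forall>j<q. \<forall>v. v \<notin> Z \<longrightarrow> g i v = g j v"
      and g2: "\<forall>i<q. \<forall>j<q. i \<noteq> j \<longrightarrow> g i ` Z \<inter> g j ` Z = {}" by (elim exE conjE)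
    have gE: "\<forall>j<q. g j \<in> embs T G" using g0 by simp
    obtain W s where W: "subtree_top W s" "W \<subseteq> Z" "good T G q (g 0) W"
      using petals_good_component[OF Z _ gE g1 g2] q2 by (meson less_trans zero_less_one)
    have "g 0 \<in> embs T G" "W \<in> \<G> (g 0)" using W gE q2 by (auto simp: \<G>_def)
    then obtain v where v: "v \<in> S (g 0)" "v \<in> W \<or> par v \<in> W" using S[of "g 0"] by blast
    \<comment> \<open>The hitting edge for \<open>W\<close> has the same image under
      \<open>g 0\<close> and \<open>g 1\<close>, yet one of its ends lies in \<open>Z\<close>, where
      the images are disjoint.\<close>
    have keq: "key (g 0) = key (g 1)" using g0 q2 by simp
    then have "S (g 0) = S (g 1)" by (simp add: key_def)
    moreover have "snd (key (g 0)) v = snd (key (g 1)) v" using keq by simp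
    ultimately have "g 0 v = g 1 v" "g 0 (par v) = g 1 (par v)" using v(1) by (simp_all add: key_def)
    then obtain x where "x \<in> Z" "g 0 x = g 1 x" using v(2) W(2) by blast
    moreover have "g 0 ` Z \<inter> g 1 ` Z = {}" using g2 q2 by simp
    ultimately show False by blast
  qed
  have "embs T G \<subseteq> (\<Union>k\<in>?K. {\<phi> \<in> embs T G. key \<phi> = k})" using keyK by blast
  moreover have "finite (\<Union>k\<in>?K. {\<phi> \<in> embs T G. key \<phi> = k})" using finE by (rule rev_finite_subset) blast
  ultimately have "card (embs T G) \<le> card (\<Union>k\<in>?K. {\<phi> \<in> embs T G. key \<phi> = k})" by (intro card_mono)
  also have "\<dots> \<le> (\<Sum>k\<in>?K. card {\<phi> \<in> embs T G. key \<phi> = k})" by (rule card_UN_le[OF finK])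
  also have "\<dots> \<le> (\<Sum>k\<in>?K. sunflower_bound q ?t)" by (rule sum_mono) (rule fibre)
  also have "\<dots> = card ?K * sunflower_bound q ?t" by simp
  also have "\<dots> \<le> 2 ^ ?t * M ^ m * sunflower_bound q ?t" by (rule mult_le_mono1[OF cK])
  finally show ?thesis .
qed

section \<open>Hosts with many edges\<close>

text \<open>Deleting a vertex of degree at most \<open>d\<close> preserves
  \<open>d * card V < card E\<close>. The deletions must stop, since an empty vertex set leaves no
  edges.\<close>

lemma min_degree_subset:
  assumes "finite V" "\<And>e. e \<in> E \<Longrightarrow> e \<subseteq> V \<and> card e = 2" "d * card V < card E"
  shows "\<exists>Y\<subseteq>V. Y \<noteq> {} \<and> (\<forall>y\<in>Y. d < card {z \<in> Y. {y, z} \<in> E})"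
  using assms
proof (induction "card V" arbitrary: V E)
  case 0
  then have "E \<subseteq> {}" by fastforce
  then show ?case using 0 by simp
next
  case (Suc n)
  show ?case
  proof (cases "\<forall>y\<in>V. d < card {z \<in> V. {y, z} \<in> E}")
    case True
    then show ?thesis using Suc.hyps(2) by (intro exI[of _ V]) auto
  next
    case False
    then obtain y where y: "y \<in> V" "card {z \<in> V. {y, z} \<in> E} \<le> d" by (auto simp: not_less)
    let ?E' = "{e \<in> E. y \<notin> e}"
    have finE: "finite E" by (rule finite_subset[of _ "Pow V"]) (use Suc.prems in auto)
    have "{e \<in> E. y \<in> e} \<subseteq> (\<lambda>z. {y, z}) ` {z \<in> V. {y, z} \<in> E}"
    proof
      fix e assume e: "e \<in> {e \<in> E. y \<in> e}"
      then have "card e = 2" "e \<subseteq> V" using Suc.prems(2) by auto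
      then obtain a b where ab: "e = {a, b}" "a \<in> V" "b \<in> V" by (auto simp: card_2_iff)
      then obtain z where "e = {y, z}" "z \<in> V" using e by (cases "a = y") auto
      then show "e \<in> (\<lambda>z. {y, z}) ` {z \<in> V. {y, z} \<in> E}" using e by auto
    qed
    then have "card {e \<in> E. y \<in> e} \<le> card {z \<in> V. {y, z} \<in> E}"
      using Suc.prems(1) by (intro surj_card_le) auto
    then have "card {e \<in> E. y \<in> e} \<le> d" using y by simp
    moreover have "card E = card ?E' + card {e \<in> E. y \<in> e}"
    proof -
      have "E = ?E' \<union> {e \<in> E. y \<in> e}" by auto
      moreover have "card (?E' \<union> {e \<in> E. y \<in> e}) = card ?E' + card {e \<in> E. y \<in> e}"
        using finE by (intro card_Un_disjoint) auto
      ultimately show ?thesis by simp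
    qed
    moreover have n: "n = card (V - {y})" using Suc.hyps(2) Suc.prems(1) y(1) by simp
    ultimately have "d * card (V - {y}) < card ?E'"
      using Suc.prems(3) Suc.hyps(2)[symmetric] by simp
    moreover have "\<And>e. e \<in> ?E' \<Longrightarrow> e \<subseteq> V - {y} \<and> card e = 2" using Suc.prems(2) by blast
    ultimately obtain Y where Y: "Y \<subseteq> V - {y}" "Y \<noteq> {}"
      "\<forall>u\<in>Y. d < card {z \<in> Y. {u, z} \<in> ?E'}"
      using Suc.hyps(1)[OF n, of ?E'] Suc.prems(1) by auto
    have "d < card {z \<in> Y. {u, z} \<in> E}" if "u \<in> Y" for u
    proof -
      have "finite Y" using Y(1) Suc.prems(1) by (meson finite_Diff finite_subset)
      then have "card {z \<in> Y. {u, z} \<in> ?E'} \<le> card {z \<in> Y. {u, z} \<in> E}"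
        by (intro card_mono) auto
      then show ?thesis using Y(3) that by fastforce
    qed
    then show ?thesis using Y by (intro exI[of _ Y]) auto
  qed
qed

text \<open>Greedy embedding: the image of \<open>x\<close> has more neighbours in \<open>Y\<close>
  than there are vertices placed so far, so one is free for the pendant vertex
  \<open>y\<close>.\<close>

lemma tree_build_embeds:
  assumes "tree_build X E" "Y \<noteq> {}" "finite Y"
    and deg: "\<And>y. y \<in> Y \<Longrightarrow> d < card {z \<in> Y. {y, z} \<in> F}" and "card X \<le> d"
  shows "finite X \<and> (\<exists>\<phi>. inj_on \<phi> X \<and> \<phi> ` X \<subseteq> Y \<and> (\<forall>e\<in>E. \<phi> ` e \<in> F))"
  using assms(1,5)
proof (induction rule: tree_build.induct)
  case (base r)
  obtain y where "y \<in> Y" using assms(2) by blast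
  then show ?case by (intro conjI exI[of _ "\<lambda>_. y"]) simp_all
next
  case (step X E x y)
  have "finite X"
    using step.hyps(1) by (induction rule: tree_build.induct) simp_all
  then have "card X \<le> d" using step by simp
  then obtain \<phi> where phi: "inj_on \<phi> X" "\<phi> ` X \<subseteq> Y" "\<forall>e\<in>E. \<phi> ` e \<in> F" using step.IH by blast
  have "card (\<phi> ` X) \<le> d" using \<open>card X \<le> d\<close> card_image_le[OF \<open>finite X\<close>, of \<phi>] by simp
  also have "d < card {z \<in> Y. {\<phi> x, z} \<in> F}" using deg phi(2) step.hyps(2) by blast
  finally have lt: "card (\<phi> ` X) < card {z \<in> Y. {\<phi> x, z} \<in> F}" .
  have "\<not> {z \<in> Y. {\<phi> x, z} \<in> F} \<subseteq> \<phi> ` X"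
  proof
    assume "{z \<in> Y. {\<phi> x, z} \<in> F} \<subseteq> \<phi> ` X"
    then have "card {z \<in> Y. {\<phi> x, z} \<in> F} \<le> card (\<phi> ` X)"
      using \<open>finite X\<close> by (intro card_mono) simp_all
    then show False using lt by simp
  qed
  then obtain z where z: "z \<in> Y" "{\<phi> x, z} \<in> F" "z \<notin> \<phi> ` X" by blast
  let ?\<psi> = "\<phi>(y := z)"
  have eq: "?\<psi> ` A = \<phi> ` A" if "A \<subseteq> X" for A
    using that step.hyps(3) by (intro image_cong) auto
  have "inj_on ?\<psi> (insert y X)"
    using phi(1) z(3) step.hyps(3) by (auto simp: inj_on_def)
  moreover have "?\<psi> ` insert y X \<subseteq> Y" using phi(2) z(1) eq[of X] by auto
  moreover have "?\<psi> ` e \<in> F" if "e \<in> insert {x, y} E" for e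
  proof (cases "e \<in> E")
    case True
    then show ?thesis using eq[OF tree_build_edges_subset[OF step.hyps(1) True]] phi(3) by simp
  next
    case False
    then have "e = {x, y}" "x \<noteq> y" using that step.hyps(2,3) by auto
    then show ?thesis using z(2) by simp
  qed
  ultimately show ?case using \<open>finite X\<close> by blast
qed


lemma leaf_edge:
  assumes T: "is_tree T" and v: "v \<in> leaves T"
  shows "\<exists>u. u \<noteq> v \<and> {e \<in> edges T. v \<in> e} = {{v, u}}"
proof -
  have "card {e \<in> edges T. v \<in> e} = 1" using v by (simp add: leaves_def degree_def)
  then obtain e where e: "{e \<in> edges T. v \<in> e} = {e}" by (rule card_1_singletonE)
  then have "e \<in> edges T" "v \<in> e" by blast+
  moreover have "card e = 2" using T \<open>e \<in> edges T\<close> by (simp add: is_tree_def fin_simple_graph_def)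
  ultimately obtain u where "e = {v, u}" "u \<noteq> v" unfolding card_2_iff by fast
  then show ?thesis using e by blast
qed

text \<open>An edge between two leaves meets no other edge, so by connectedness it is the whole
  tree. This is where \<open>T\<close> being different from the single edge enters.\<close>

lemma leaves_not_adjacent:
  assumes T: "is_tree T" and K2: "\<not> isomorphic T (complete_graph 2)"
    and v: "v \<in> leaves T" and w: "w \<in> leaves T"
  shows "{v, w} \<notin> edges T"
proof
  assume e: "{v, w} \<in> edges T"
  have es: "e \<subseteq> verts T \<and> card e = 2" if "e \<in> edges T" for e
    using T that by (simp add: is_tree_def fin_simple_graph_def)
  have vw: "v \<in> verts T" "w \<in> verts T" using v w by (simp_all add: leaves_def)
  have "card {v, w} = 2" using es[OF e] by simp
  then have ne: "v \<noteq> w" by auto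
  obtain u where u: "{e \<in> edges T. v \<in> e} = {{v, u}}" using leaf_edge[OF T v] by blast
  obtain u' where u': "{e \<in> edges T. w \<in> e} = {{w, u'}}" using leaf_edge[OF T w] by blast
  have only_v: "f = {v, w}" if "f \<in> edges T" "v \<in> f" for f
  proof -
    have "f \<in> {e \<in> edges T. v \<in> e}" "{v, w} \<in> {e \<in> edges T. v \<in> e}"
      using that e by simp_all
    then show ?thesis unfolding u by simp
  qed
  have only_w: "f = {v, w}" if "f \<in> edges T" "w \<in> f" for f
  proof -
    have "f \<in> {e \<in> edges T. w \<in> e}" "{v, w} \<in> {e \<in> edges T. w \<in> e}"
      using that e by simp_all
    then show ?thesis unfolding u' by simp
  qed
  have V: "verts T = {v, w}"
  proof
    show "{v, w} \<subseteq> verts T" using vw by simp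
    show "verts T \<subseteq> {v, w}"
    proof
      fix x assume "x \<in> verts T"
      then have "(v, x) \<in> {(x, y). {x, y} \<in> edges T}\<^sup>*"
        using T vw by (simp add: is_tree_def connected_graph_def)
      then show "x \<in> {v, w}"
      proof (induction rule: rtrancl_induct)
        case (step y z)
        then have "{y, z} \<in> edges T" by simp
        then have "{y, z} = {v, w}" using step.IH only_v only_w by blast
        then show ?case by blast
      qed simp
    qed
  qed
  have "f = {v, w}" if f: "f \<in> edges T" for f
  proof -
    have "f \<noteq> {}" "f \<subseteq> {v, w}" using es[OF f] V by auto
    then show ?thesis using only_v[OF f] only_w[OF f] by blast
  qed
  then have E: "edges T = {{v, w}}" using e by blast
  define h where "h x = (if x = v then 0 else 1 :: nat)" for x
  have h: "h v = 0" "h w = 1" using ne by (simp_all add: h_def)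
  have two: "{..<2} = {0, 1 :: nat}" by auto
  have "{e. e \<subseteq> {..<2} \<and> card e = 2} = {{0, 1 :: nat}}"
  proof -
    have "e = {0, 1}" if "e \<subseteq> {0, 1}" "card e = 2" for e :: "nat set"
      using that card_subset_eq[of "{0, 1 :: nat}" e] by simp
    then show ?thesis unfolding two by auto
  qed
  then have K: "complete_graph 2 = ({0, 1}, {{0, 1}})" unfolding complete_graph_def two by simp
  have "bij_betw h (verts T) (verts (complete_graph 2))"
    unfolding K V by (simp add: bij_betw_def inj_on_def h ne)
  moreover have "(\<lambda>e. h ` e) ` edges T = edges (complete_graph 2)"
    unfolding K E by (simp add: h)
  ultimately show False using K2 by (auto simp: isomorphic_def)
qed

text \<open>A leaf can be moved to any neighbour in \<open>Y\<close> of the image of its unique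
  neighbour \<open>u\<close> that is not yet occupied, and the degree condition leaves at least
  \<open>q\<close> of these.\<close>

lemma good_leaf:
  assumes T: "is_tree T" and v: "v \<in> leaves T"
    and phi: "inj_on \<phi> (verts T)" "\<phi> ` verts T \<subseteq> Y" "\<forall>e\<in>edges T. \<phi> ` e \<in> edges G"
    and Y: "Y \<subseteq> verts G" "finite Y"
    and deg: "\<And>y. y \<in> Y \<Longrightarrow> card (verts T) + q < card {z \<in> Y. {y, z} \<in> edges G}"
  shows "good T G q (restrict \<phi> (verts T)) {v}"
proof -
  obtain u where u: "u \<noteq> v" "{e \<in> edges T. v \<in> e} = {{v, u}}" using leaf_edge[OF T v] by blast
  have finT: "finite (verts T)" and es: "\<And>e. e \<in> edges T \<Longrightarrow> e \<subseteq> verts T"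
    using T by (simp_all add: is_tree_def fin_simple_graph_def)
  have vu: "{v, u} \<in> edges T" using u(2) by blast
  then have uV: "u \<in> verts T" and vV: "v \<in> verts T" using es by blast+
  let ?N = "{z \<in> Y. {\<phi> u, z} \<in> edges G}"
  have "card (\<phi> ` verts T) \<le> card (verts T)" by (rule card_image_le[OF finT])
  moreover have "card (verts T) + q < card ?N" using deg phi(2) uV by blast
  moreover have "card ?N - card (\<phi> ` verts T) \<le> card (?N - \<phi> ` verts T)"
    using finT by (intro diff_card_le_card_Diff) simp
  ultimately have "q \<le> card (?N - \<phi> ` verts T)" by linarith
  then obtain Z where Z: "Z \<subseteq> ?N - \<phi> ` verts T" "card Z = q" "finite Z"
    by (rule obtain_subset_with_card_n)
  then obtain h where h: "bij_betw h {0..<q} Z" using ex_bij_betw_nat_finite by blast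
  have hZ: "h j \<in> Z" if "j < q" for j using h that by (auto simp: bij_betw_def)
  define g where "g j = (restrict \<phi> (verts T))(v := h j)" for j
  have gv: "g j v = h j" for j by (simp add: g_def)
  have go: "g j x = \<phi> x" if "x \<in> verts T" "x \<noteq> v" for j x using that by (simp add: g_def)
  have "g j \<in> embs T G" if j: "j < q" for j
    unfolding embs_def
  proof (intro CollectI conjI ballI)
    have hj: "h j \<in> Y" "{\<phi> u, h j} \<in> edges G" "h j \<notin> \<phi> ` verts T" using hZ[OF j] Z(1) by blast+
    show "g j \<in> verts T \<rightarrow>\<^sub>E verts G"
    proof (rule PiE_I)
      fix x assume x: "x \<in> verts T"
      show "g j x \<in> verts G"
      proof (cases "x = v")
        case True
        then show ?thesis using hj(1) Y(1) gv by auto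
      next
        case False
        then show ?thesis using go[OF x False] phi(2) x Y(1) by auto
      qed
    next
      fix x assume "x \<notin> verts T"
      then show "g j x = undefined" using vV by (auto simp: g_def)
    qed
    show "inj_on (g j) (verts T)"
    proof (rule inj_onI)
      fix x y assume xy: "x \<in> verts T" "y \<in> verts T" "g j x = g j y"
      consider "x = v" "y = v" | "x = v" "y \<noteq> v" | "x \<noteq> v" "y = v" | "x \<noteq> v" "y \<noteq> v" by blast
      then show "x = y"
      proof cases
        case 2
        then have "h j = \<phi> y" using xy gv go by simp
        then show ?thesis using hj(3) xy by blast
      next
        case 3
        then have "h j = \<phi> x" using xy gv go by simp
        then show ?thesis using hj(3) xy by blast
      next
        case 4
        then have "\<phi> x = \<phi> y" using xy go by simp
        then show ?thesis using phi(1) xy by (simp add: inj_on_def)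
      qed simp
    qed
    fix e assume e: "e \<in> edges T"
    show "g j ` e \<in> edges G"
    proof (cases "v \<in> e")
      case True
      then have "e = {v, u}" using u(2) e by blast
      then have "g j ` e = {h j, \<phi> u}" using gv go[OF uV u(1)] by simp
      then show ?thesis using hj(2) by (simp add: insert_commute)
    next
      case False
      then have "g j ` e = \<phi> ` e" using es[OF e] by (intro image_cong[OF refl] go) auto
      then show ?thesis using phi(3) e by simp
    qed
  qed
  moreover have "g j y = restrict \<phi> (verts T) y" if "y \<in> boundary T {v}" for j y
    using that by (simp add: g_def boundary_def)
  moreover have "g i ` {v} \<inter> g j ` {v} = {}" if "i < q" "j < q" "i \<noteq> j" for i j
  proof -
    have "h i \<noteq> h j" using h that by (auto simp: bij_betw_def inj_on_def)
    then show ?thesis by (simp add: gv)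
  qed
  ultimately show ?thesis unfolding good_def by blast
qed

text \<open>A subset of large minimum degree receives \<open>T\<close> greedily. There every leaf is
  movable on its own, and the leaves are pairwise separated because no two are adjacent.\<close>

lemma dense_blowup:
  assumes T: "is_tree T" "\<not> isomorphic T (complete_graph 2)"
    and G: "fin_simple_graph G"
    and q: "q = Suc (card (verts T) + card (verts T) * (card (leaves T) * p))"
    and dense: "(card (verts T) + q) * card (verts G) < card (edges G)"
  shows "blowup T G p ((\<lambda>v. {v}) ` leaves T)" "q \<le> card (verts G)"
proof -
  let ?t = "card (verts T)"
  have finT: "finite (verts T)" and fsT: "fin_simple_graph T"
    using T(1) by (simp_all add: is_tree_def fin_simple_graph_def)
  have finG: "finite (verts G)" and esG: "\<And>e. e \<in> edges G \<Longrightarrow> e \<subseteq> verts G \<and> card e = 2"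
    using G by (simp_all add: fin_simple_graph_def)
  obtain Y where Y: "Y \<subseteq> verts G" "Y \<noteq> {}" "\<forall>y\<in>Y. ?t + q < card {z \<in> Y. {y, z} \<in> edges G}"
  proof -
    have "\<exists>Y\<subseteq>verts G. Y \<noteq> {} \<and> (\<forall>y\<in>Y. ?t + q < card {z \<in> Y. {y, z} \<in> edges G})"
      by (rule min_degree_subset[OF finG _ dense]) (rule esG)
    then show ?thesis by (elim exE conjE) (rule that)
  qed
  have finY: "finite Y" using Y(1) finG by (rule finite_subset)
  obtain y where y: "y \<in> Y" using Y(2) by blast
  have "card {z \<in> Y. {y, z} \<in> edges G} \<le> card (verts G)"
    using Y(1) finG by (intro card_mono) auto
  moreover have "?t + q < card {z \<in> Y. {y, z} \<in> edges G}" using Y(3) y by blast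
  ultimately show "q \<le> card (verts G)" by linarith
  have "finite (verts T) \<and> (\<exists>\<phi>. inj_on \<phi> (verts T) \<and> \<phi> ` verts T \<subseteq> Y \<and> (\<forall>e\<in>edges T. \<phi> ` e \<in> edges G))"
    by (rule tree_build_embeds[OF tree_build_of_tree[OF T(1)] Y(2) finY, of "?t + q"])
      (use Y(3) in simp_all)
  then obtain \<phi> where phi: "inj_on \<phi> (verts T)" "\<phi> ` verts T \<subseteq> Y" "\<forall>e\<in>edges T. \<phi> ` e \<in> edges G"
    by (elim exE conjE)
  show "blowup T G p ((\<lambda>v. {v}) ` leaves T)"
  proof (rule blowup_of_good[OF fsT, where \<phi> = "restrict \<phi> (verts T)" and q = q])
    have "restrict \<phi> (verts T) ` e = \<phi> ` e" if "e \<in> edges T" for e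
      using fsT that by (intro image_cong) (auto simp: fin_simple_graph_def)
    then show "restrict \<phi> (verts T) \<in> embs T G"
      using phi Y(1) by (auto simp: embs_def inj_on_def)
    show "(\<lambda>v. {v}) ` leaves T \<subseteq> Pow (verts T) - {{}}" by (auto simp: leaves_def)
    show "pairwise (separated T) ((\<lambda>v. {v}) ` leaves T)"
    proof (rule pairwiseI)
      fix A B assume "A \<in> (\<lambda>v. {v}) ` leaves T" "B \<in> (\<lambda>v. {v}) ` leaves T" "A \<noteq> B"
      then obtain v w where "A = {v}" "B = {w}" "v \<in> leaves T" "w \<in> leaves T" "v \<noteq> w" by blast
      then show "separated T A B" using leaves_not_adjacent[OF T] by (simp add: separated_def)
    qed
    show "good T G q (restrict \<phi> (verts T)) W" if "W \<in> (\<lambda>v. {v}) ` leaves T" for W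
      using that good_leaf[OF T(1) _ phi Y(1) finY] Y(3) by blast
    have "card ((\<lambda>v. {v}) ` leaves T) = card (leaves T)" by (intro card_image) simp
    then show "?t + ?t * (card ((\<lambda>v. {v}) ` leaves T) * p) < q" unfolding q by simp
  qed
qed

section \<open>Bounds for the generalized Turan number\<close>

lemma family_free_subgraph:
  assumes "family_free \<F> G" "verts H \<subseteq> verts G" "edges H \<subseteq> edges G"
  shows "family_free \<F> H"
proof -
  have "copies F H \<subseteq> copies F G" for F :: "'a ugraph"
    using assms(2,3) by (auto simp: copies_def subgraph_def)
  then show ?thesis using assms(1) unfolding family_free_def by blast
qed

lemma le_gen_turan:
  fixes G :: "nat ugraph"
  assumes "fin_simple_graph G" "card (verts G) = n" "family_free \<F> G"
  shows "card (copies T G) \<le> gen_turan n T \<F>"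
proof -
  have "card (copies T G) \<in> copy_counts n T \<F>" using assms unfolding copy_counts_def by blast
  then show ?thesis unfolding gen_turan_def using finite_copy_counts[of n T \<F>] by auto
qed

lemma gen_turan_le:
  assumes "\<And>G :: nat ugraph. fin_simple_graph G \<Longrightarrow> card (verts G) = n \<Longrightarrow> family_free \<F> G \<Longrightarrow>
    card (copies T G) \<le> b"
  shows "gen_turan n T \<F> \<le> b"
proof (cases "copy_counts n T \<F> = {}")
  case False
  then have "Max (copy_counts n T \<F>) \<in> copy_counts n T \<F>" using finite_copy_counts by (rule Max_in[rotated])
  moreover have "c \<le> b" if "c \<in> copy_counts n T \<F>" for c
    using that assms by (auto simp: copy_counts_def)
  ultimately have "Max (copy_counts n T \<F>) \<le> b" by blast
  then show ?thesis using False by (simp add: gen_turan_def)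
qed (simp add: gen_turan_def)

text \<open>The parameter \<open>p\<close> also bounds the order of the host from below. For
  \<open>m = 0\<close> this is a genuine condition, because a blow-up without parts is just an
  embedding.\<close>

definition free_blowups :: "'a ugraph \<Rightarrow> 'b ugraph set \<Rightarrow> nat \<Rightarrow> bool" where
  "free_blowups T \<F> m \<longleftrightarrow> (\<forall>p. \<exists>G :: nat ugraph. fin_simple_graph G \<and> family_free \<F> G \<and>
    p \<le> card (verts G) \<and> (\<exists>\<W>. card \<W> = m \<and> blowup T G p \<W>))"

text \<open>With \<open>n div card (verts T)\<close> replicas the blow-up occupies at most
  \<open>n\<close> vertices; it is padded inside the host to exactly \<open>n\<close>.\<close>

lemma free_blowups_lower:
  assumes T: "fin_simple_graph T" "verts T \<noteq> {}" and fb: "free_blowups T \<F> m"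
    and n: "card (verts T) \<le> n"
  shows "(n div card (verts T)) ^ m \<le> gen_turan n T \<F>"
proof -
  let ?t = "card (verts T)" and ?p = "n div card (verts T)"
  have "0 < ?t" using T by (auto simp: fin_simple_graph_def card_gt_0_iff)
  then have p: "1 \<le> ?p" using n by (simp add: Suc_le_eq div_greater_zero_iff)
  obtain G :: "nat ugraph" and \<W> where G: "fin_simple_graph G" "family_free \<F> G"
    "n \<le> card (verts G)" and W: "card \<W> = m" "blowup T G n \<W>"
    using fb unfolding free_blowups_def by blast
  \<comment> \<open>The parameter \<open>n\<close> was requested to get a host of order at least
    \<open>n\<close>; only \<open>?p\<close> of the replicas are kept.\<close>
  have bl: "blowup T G ?p \<W>" using W(2) by (rule blowup_mono) simp
  obtain X where X: "X \<subseteq> verts G" "card X \<le> ?p * ?t"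
    "\<forall>Y. X \<subseteq> Y \<longrightarrow> Y \<subseteq> verts G \<longrightarrow> ?p ^ card \<W> \<le> card (copies T (induced G Y))"
    using blowup_copies[OF T(1) G(1) bl p] by (elim exE conjE)
  have finG: "finite (verts G)" using G(1) by (simp add: fin_simple_graph_def)
  have "card X \<le> n" using X(2) by (meson div_times_less_eq_dividend le_trans)
  then obtain Y where Y: "X \<subseteq> Y" "Y \<subseteq> verts G" "card Y = n"
    using exists_subset_between[OF _ G(3) X(1) finG] by blast
  have "fin_simple_graph (induced G Y)"
    using G(1) Y(2) finG by (auto simp: fin_simple_graph_def induced_def intro: finite_subset)
  moreover have "card (verts (induced G Y)) = n" using Y(3) by (simp add: induced_def)
  moreover have "family_free \<F> (induced G Y)"
    using G(2) by (rule family_free_subgraph) (use Y(2) in \<open>auto simp: induced_def\<close>)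
  ultimately have "card (copies T (induced G Y)) \<le> gen_turan n T \<F>" by (rule le_gen_turan)
  moreover have "?p ^ m \<le> card (copies T (induced G Y))" using X(3) Y W(1) by blast
  ultimately show ?thesis by linarith
qed

lemma free_blowups_bigomega:
  assumes T: "fin_simple_graph T" "verts T \<noteq> {}" and fb: "free_blowups T \<F> m"
  shows "(\<lambda>n. real (gen_turan n T \<F>)) \<in> \<Omega>(\<lambda>n. real n ^ m)"
proof -
  let ?t = "card (verts T)"
  have t: "0 < ?t" using T by (auto simp: fin_simple_graph_def card_gt_0_iff)
  \<comment> \<open>The constant comes from \<open>n \<le> 2 * ?t * (n div ?t)\<close>, valid once
    \<open>n div ?t \<ge> 1\<close>.\<close>
  have "norm (real n ^ m) * (1 / (2 * real ?t)) ^ m \<le> norm (real (gen_turan n T \<F>))" if n: "?t \<le> n" for n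
  proof -
    have p: "1 \<le> n div ?t" using n t by (simp add: Suc_le_eq div_greater_zero_iff)
    have "n < ?t * Suc (n div ?t)" using t by (simp add: dividend_less_times_div)
    also have "\<dots> \<le> ?t * (2 * (n div ?t))" using p by (intro mult_le_mono2) linarith
    finally have "real n \<le> real (?t * (2 * (n div ?t)))" by (simp only: of_nat_le_iff less_imp_le)
    then have "real n * (1 / (2 * real ?t)) \<le> real (n div ?t)"
      using t by (simp add: field_simps)
    then have "(real n * (1 / (2 * real ?t))) ^ m \<le> real (n div ?t) ^ m" by (intro power_mono) simp_all
    also have "\<dots> = real ((n div ?t) ^ m)" by simp
    also have "\<dots> \<le> real (gen_turan n T \<F>)"
      using free_blowups_lower[OF T fb n] by (simp only: of_nat_le_iff)
    finally show ?thesis unfolding power_mult_distrib by simp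
  qed
  then have "\<forall>\<^sub>F n in sequentially. (1 / (2 * real ?t)) ^ m * norm (real n ^ m) \<le> norm (real (gen_turan n T \<F>))"
    unfolding eventually_sequentially by (metis mult.commute)
  moreover have "0 < (1 / (2 * real ?t)) ^ m" using t by simp
  ultimately show ?thesis by (intro landau_omega.bigI)
qed

text \<open>One fixed \<open>p\<close> excludes blow-ups with \<open>Suc m\<close> parts in all
  large free hosts, and sparsity makes the number of ordered edges linear in \<open>n\<close>, so
  \<open>card_embs_bound\<close> gives order \<open>n ^ m\<close>.\<close>

lemma no_free_blowups_bigo:
  assumes T: "is_tree T" "leaves T \<noteq> {}" and nb: "\<not> free_blowups T \<F> (Suc m)"
    and sparse: "\<And>G :: nat ugraph. fin_simple_graph G \<Longrightarrow> family_free \<F> G \<Longrightarrow> d \<le> card (verts G) \<Longrightarrow>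
      card (edges G) \<le> c * card (verts G)"
  shows "(\<lambda>n. real (gen_turan n T \<F>)) \<in> O(\<lambda>n. real n ^ m)"
proof -
  let ?t = "card (verts T)"
  have fsT: "fin_simple_graph T" using T(1) by (simp add: is_tree_def)
  obtain p where p: "\<And>G :: nat ugraph. \<And>\<W>. fin_simple_graph G \<Longrightarrow> family_free \<F> G \<Longrightarrow>
    p \<le> card (verts G) \<Longrightarrow> card \<W> = Suc m \<Longrightarrow> \<not> blowup T G p \<W>"
    using nb unfolding free_blowups_def by blast
  obtain r par idx where "rooted_tree (verts T, edges T) r par idx"
    using rooted_tree_of_build[OF tree_build_of_tree[OF T(1)]] by blast
  then interpret rooted_tree T r par idx by simp
  have ne: "verts T \<noteq> {r}"
  proof
    assume "verts T = {r}"
    then have "edges T = {}" using edges_eq by simp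
    moreover obtain v where "v \<in> leaves T" using T(2) by blast
    ultimately show False by (simp add: leaves_def degree_def)
  qed
  define q where "q = Suc (?t + ?t * (Suc m * p))"
  define K where "K = 2 ^ ?t * (2 * c + 1) ^ m * sunflower_bound q ?t"
  \<comment> \<open>At least \<open>p\<close> vertices to exclude blow-ups, at least
    \<open>d\<close> for sparsity, and at least 1 to make \<open>(2 * c + 1) * n\<close>
    positive.\<close>
  have "gen_turan n T \<F> \<le> K * n ^ m" if n: "p + d + 1 \<le> n" for n
  proof (rule gen_turan_le)
    fix G :: "nat ugraph" assume G: "fin_simple_graph G" "card (verts G) = n" "family_free \<F> G"
    have "card (edges G) \<le> c * n" using sparse[OF G(1,3)] G(2) n by simp
    then have M: "2 * card (edges G) \<le> (2 * c + 1) * n" "1 \<le> (2 * c + 1) * n"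
      using n by (auto simp: algebra_simps)
    have nb': "\<not> blowup T G p \<W>" if "card \<W> = Suc m" for \<W>
      using p[OF G(1,3) _ that] G(2) n by simp
    have "card (copies T G) \<le> card (embs T G)" by (rule card_copies_le_embs[OF fsT G(1)])
    also have "\<dots> \<le> 2 ^ ?t * ((2 * c + 1) * n) ^ m * sunflower_bound q ?t"
      by (rule card_embs_bound[OF fsT G(1) ne nb' q_def M])
    also have "\<dots> = K * n ^ m" unfolding K_def power_mult_distrib by (simp only: mult_ac)
    finally show "card (copies T G) \<le> K * n ^ m" .
  qed
  then have "norm (real (gen_turan n T \<F>)) \<le> real K * norm (real n ^ m)" if "p + d + 1 \<le> n" for n
    using that by (simp flip: of_nat_power of_nat_mult)
  then show ?thesis by (intro bigoI[where c = "real K"]) (auto simp: eventually_sequentially)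
qed

text \<open>A crude bound, so that a greatest \<open>m\<close> exists. The conditions on the parts
  do not involve the number of replicas, so zero replicas suffice.\<close>

lemma free_blowups_le:
  assumes "fin_simple_graph T" "free_blowups T \<F> m"
  shows "m \<le> 2 ^ card (verts T)"
proof -
  obtain G :: "nat ugraph" and \<W> where W: "card \<W> = m" "blowup T G 0 \<W>"
    using assms(2) unfolding free_blowups_def by blast
  have fin: "finite (verts T)" using assms(1) by (simp add: fin_simple_graph_def)
  have "\<W> \<subseteq> Pow (verts T)" using blowup_subset[OF W(2)] by blast
  then have "card \<W> \<le> card (Pow (verts T))" using fin by (intro card_mono) simp_all
  then show ?thesis using W(1) fin by (simp add: card_Pow)
qed

text \<open>With no parts to replicate, a constant family made of one embedding is a blow-up for
  every \<open>p\<close>.\<close>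

lemma free_blowups_zero:
  assumes T: "fin_simple_graph T" and ex: "\<And>p. \<exists>n\<ge>p. gen_turan n T \<F> \<noteq> 0"
  shows "free_blowups T \<F> 0"
  unfolding free_blowups_def
proof
  fix p
  obtain n where n: "p \<le> n" "gen_turan n T \<F> \<noteq> 0" using ex by blast
  have "\<not> (\<forall>G :: nat ugraph. fin_simple_graph G \<longrightarrow> card (verts G) = n \<longrightarrow> family_free \<F> G \<longrightarrow>
    card (copies T G) \<le> 0)"
    using gen_turan_le[of n \<F> T 0] n(2) by blast
  then obtain G :: "nat ugraph" where G: "fin_simple_graph G" "card (verts G) = n" "family_free \<F> G"
    "card (copies T G) \<noteq> 0" by auto
  then have "card (embs T G) \<noteq> 0" using card_copies_le_embs[OF T G(1)] by linarith
  then obtain \<phi> where "\<phi> \<in> embs T G" by (metis card.empty equals0I)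
  then have "blowup T G p {}" unfolding blowup_def by (auto intro!: exI[of _ "\<lambda>_. \<phi>"])
  then show "\<exists>G :: nat ugraph. fin_simple_graph G \<and> family_free \<F> G \<and>
    p \<le> card (verts G) \<and> (\<exists>\<W>. card \<W> = 0 \<and> blowup T G p \<W>)"
    using G n(1) card.empty by blast
qed

lemma free_blowups_leaves:
  assumes T: "is_tree T" "\<not> isomorphic T (complete_graph 2)" "leaves T \<noteq> {}"
    and dense: "\<And>c d. \<exists>G :: nat ugraph. fin_simple_graph G \<and> family_free \<F> G \<and> d \<le> card (verts G) \<and>
      c * card (verts G) < card (edges G)"
  shows "free_blowups T \<F> (card (leaves T))"
  unfolding free_blowups_def
proof
  fix p
  define q where "q = Suc (card (verts T) + card (verts T) * (card (leaves T) * p))"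
  obtain G :: "nat ugraph" where G: "fin_simple_graph G" "family_free \<F> G" "p \<le> card (verts G)"
    "(card (verts T) + q) * card (verts G) < card (edges G)"
    using dense by blast
  have "blowup T G p ((\<lambda>v. {v}) ` leaves T)" by (rule dense_blowup[OF T(1,2) G(1) q_def G(4)])
  moreover have "card ((\<lambda>v. {v}) ` leaves T) = card (leaves T)" by (intro card_image) simp
  ultimately show "\<exists>G :: nat ugraph. fin_simple_graph G \<and> family_free \<F> G \<and>
    p \<le> card (verts G) \<and> (\<exists>\<W>. card \<W> = card (leaves T) \<and> blowup T G p \<W>)"
    using G by blast
qed

theorem corollary2p7:
  fixes T :: "'a ugraph" and \<F> :: "'b ugraph set" and l :: nat
  assumes "is_tree T"
    and "\<not> isomorphic T (complete_graph 2)"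
    and "card (leaves T) = l" and "l \<ge> 2"
    and "\<forall>F\<in>\<F>. fin_simple_graph F"
    and "(\<lambda>n. real (gen_turan n T \<F>)) \<in> O(\<lambda>n. real n ^ l)"
  shows "(\<exists>k::int. (\<lambda>n. real (gen_turan n T \<F>)) \<in> \<Theta>(\<lambda>n. real n powi k)) \<or>
         (\<forall>\<^sub>F n in sequentially. gen_turan n T \<F> = 0)"
proof -
  let ?f = "\<lambda>n. real (gen_turan n T \<F>)"
  have fsT: "fin_simple_graph T" and V: "verts T \<noteq> {}" and L: "leaves T \<noteq> {}"
    using assms(1,3,4) by (auto simp: is_tree_def connected_graph_def)
  have theta: ?thesis if "?f \<in> \<Omega>(\<lambda>n. real n ^ k)" "?f \<in> O(\<lambda>n. real n ^ k)" for k
  proof -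
    have "?f \<in> \<Theta>(\<lambda>n. real n ^ k)" using that by (rule bigthetaI[rotated])
    then have "?f \<in> \<Theta>(\<lambda>n. real n powi int k)" by simp
    then show ?thesis by blast
  qed
  show ?thesis
  proof (cases "\<exists>p. \<forall>n\<ge>p. gen_turan n T \<F> = 0")
    case True
    then show ?thesis by (simp add: eventually_sequentially)
  next
    case False
    then have zero: "free_blowups T \<F> 0" by (intro free_blowups_zero[OF fsT]) blast
    show ?thesis
    proof (cases "\<forall>c d. \<exists>G :: nat ugraph. fin_simple_graph G \<and> family_free \<F> G \<and> d \<le> card (verts G) \<and>
        c * card (verts G) < card (edges G)")
      case True
      then have "free_blowups T \<F> l"
        using free_blowups_leaves[OF assms(1,2) L] assms(3) by blast
      \<comment> \<open>Replicating all \<open>l\<close> leaves gives the lower bound of order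
        \<open>n ^ l\<close>, matching the assumed upper bound.\<close>
      then show ?thesis using theta[OF free_blowups_bigomega[OF fsT V]] assms(6) by blast
    next
      case False
      then obtain c d where cd: "\<And>G :: nat ugraph. fin_simple_graph G \<Longrightarrow> family_free \<F> G \<Longrightarrow>
        d \<le> card (verts G) \<Longrightarrow> card (edges G) \<le> c * card (verts G)"
        by (meson not_less)
      \<comment> \<open>The exponent for sparse hosts: blow-ups with \<open>m\<close> parts give the
        lower bound, their absence for \<open>Suc m\<close> parts the upper bound.\<close>
      define m where "m = (GREATEST m. free_blowups T \<F> m)"
      have m: "free_blowups T \<F> m" unfolding m_def
        using zero free_blowups_le[OF fsT] by (rule GreatestI_nat)
      have "\<not> free_blowups T \<F> (Suc m)"
      proof
        assume "free_blowups T \<F> (Suc m)"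
        then have "Suc m \<le> m" unfolding m_def
          using free_blowups_le[OF fsT] by (rule Greatest_le_nat)
        then show False by simp
      qed
      then have "?f \<in> O(\<lambda>n. real n ^ m)" by (rule no_free_blowups_bigo[OF assms(1) L _ cd])
      then show ?thesis using theta[OF free_blowups_bigomega[OF fsT V m]] by blast
    qed
  qed
qed

end
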